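(* Let $M_1,M_2$ be matroids of positive rank on disjoint ground sets $S_1,S_2$, such that no matroid isomorphic to $M_1$ can be obtained from $M_2$ by any combination of taking minors, free extensions and free coextensions, and no matroid isomorphic to $M_2$ can be obtained from $M_1$ in this way. For $i\in\{1,2\}$ fix a set $S'_i$ with $FI(M_i)\subseteq S'_i\subseteq S_i-FI(M_i^* )$. Let $k\ge 4\max\{|S_1|,|S_2|\}$ be an integer and let $T_1,T_2$ be sets with $|T_1|=k-r(M_1)-|S'_2|$ and $|T_2|=k-r(M_2)-|S'_1|$ such that $T_1,T_2,S_1\cup S_2$ are pairwise disjoint. Then the matroid $M=M_k(M_1,S'_1,T_1;M_2,S'_2,T_2)$ is an intertwine of $M_1$ and $M_2$.
   Context: All matroids are finite. A cyclic flat is a flat that is a (possibly empty) union of circuits; for a matroid $N$, $\mathcal{Z}'(N)$ denotes its set of nonempty proper cyclic flats, and $\eta_N(Y)=|Y|-r_N(Y)$ is the nullity. The free extension $N+x$ by a new element $x$ has as circuits those of $N$ together with $B\cup x$ for bases $B$ of $N$; the free coextension is $N\times x=(N^*+x)^*$. $FI(N)$ is the set of elements of $N$ lying in no proper cyclic flat of $N$ (the free elements and isthmuses of $N$); thus $FI(N^* )$ is the intersection of all nonempty cyclic flats of $N$ (the cofree elements and loops). A matroid $M$ is an intertwine of $N_1$ and $N_2$ if $M$ has minors isomorphic to $N_1$ and to $N_2$, but no proper minor of $M$ has both. Construction $M_k(N_1,A_1,U_1;N_2,A_2,U_2)$: let $N_1,N_2$ be matroids of positive rank on disjoint ground sets $R_1,R_2$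 with rank functions $\rho_1,\rho_2$; let $A_1\subseteq R_1$, $A_2\subseteq R_2$; let $k$ be an integer with $k\ge r(N_1)+\eta_{N_1}(A_1)+r(N_2)+\eta_{N_2}(A_2)$; and let $U_1,U_2$ be sets with $|U_1|=k-r(N_1)-|A_2|$, $|U_2|=k-r(N_2)-|A_1|$, such that $U_1,U_2,R_1\cup R_2$ are pairwise disjoint. Let $E=R_1\cup R_2\cup U_1\cup U_2$. Then $M_k(N_1,A_1,U_1;N_2,A_2,U_2)$ is the (existing and unique) matroid on $E$ whose cyclic flats are exactly: $\emptyset$, of rank $0$; $E$, of rank $k$; the sets $F\cup U_1\cup A_2$ for $F\in\mathcal{Z}'(N_1)$, of rank $\rho_1(F)+|U_1|+|A_2|$; and the sets $F\cup U_2\cup A_1$ for $F\in\mathcal{Z}'(N_2)$, of rank $\rho_2(F)+|U_2|+|A_1|$. *)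

theory Defs
  imports Main "HOL-Library.Infinite_Typeclass"
begin

text \<open>
  A matroid is a value of the following record type satisfying the predicate \<open>matroid\<close>.
  Independent sets are required to be subsets of the ground set, so that two matroids are
  the same precisely when they are equal as records.
\<close>

record 'a mat =
  ground :: "'a set"
  indeps :: "'a set set"

definition matroid :: "'a mat \<Rightarrow> bool" where
  "matroid M \<longleftrightarrow>
     finite (ground M) \<and>
     (\<forall>I\<in>indeps M. I \<subseteq> ground M) \<and>
     {} \<in> indeps M \<and>
     (\<forall>I\<in>indeps M. \<forall>J. J \<subseteq> I \<longrightarrow> J \<in> indeps M) \<and>
     (\<forall>I\<in>indeps M. \<forall>J\<in>indeps M. card I < card J \<longrightarrow> (\<exists>x\<in>J - I. insert x I \<in> indeps M))"

definition bases :: "'a mat \<Rightarrow> 'a set set" where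
  "bases M = {B \<in> indeps M. \<forall>I\<in>indeps M. B \<subseteq> I \<longrightarrow> I = B}"

definition circuits :: "'a mat \<Rightarrow> 'a set set" where
  "circuits M = {C. C \<subseteq> ground M \<and> C \<notin> indeps M \<and> (\<forall>D. D \<subset> C \<longrightarrow> D \<in> indeps M)}"

definition rk :: "'a mat \<Rightarrow> 'a set \<Rightarrow> nat" where
  "rk M X = Max (card ` {I \<in> indeps M. I \<subseteq> X})"

abbreviation rank :: "'a mat \<Rightarrow> nat" where
  "rank M \<equiv> rk M (ground M)"

definition flat :: "'a mat \<Rightarrow> 'a set \<Rightarrow> bool" where
  "flat M F \<longleftrightarrow> F \<subseteq> ground M \<and> (\<forall>x\<in>ground M - F. rk M F < rk M (insert x F))"

definition cyclic_flats :: "'a mat \<Rightarrow> 'a set set" where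
  "cyclic_flats M = {F. flat M F \<and> (\<exists>\<C> \<subseteq> circuits M. F = \<Union>\<C>)}"

definition nonempty_proper_cyclic_flats :: "'a mat \<Rightarrow> 'a set set" where
  "nonempty_proper_cyclic_flats M = {F \<in> cyclic_flats M. F \<noteq> {} \<and> F \<noteq> ground M}"

definition dual :: "'a mat \<Rightarrow> 'a mat" where
  "dual M = \<lparr>ground = ground M, indeps = {I. I \<subseteq> ground M \<and> (\<exists>B\<in>bases M. I \<inter> B = {})}\<rparr>"

definition delete :: "'a mat \<Rightarrow> 'a set \<Rightarrow> 'a mat" where
  "delete M X = \<lparr>ground = ground M - X, indeps = {I \<in> indeps M. I \<inter> X = {}}\<rparr>"

definition contract :: "'a mat \<Rightarrow> 'a set \<Rightarrow> 'a mat" where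
  "contract M X = dual (delete (dual M) X)"

definition minor :: "'a mat \<Rightarrow> 'a mat \<Rightarrow> bool" where
  "minor N M \<longleftrightarrow>
     (\<exists>X Y. X \<subseteq> ground M \<and> Y \<subseteq> ground M \<and> X \<inter> Y = {} \<and> N = delete (contract M X) Y)"

definition proper_minor :: "'a mat \<Rightarrow> 'a mat \<Rightarrow> bool" where
  "proper_minor N M \<longleftrightarrow> minor N M \<and> N \<noteq> M"

definition isomorphic :: "'a mat \<Rightarrow> 'b mat \<Rightarrow> bool" where
  "isomorphic M N \<longleftrightarrow>
     (\<exists>f. bij_betw f (ground M) (ground N) \<and>
          (\<forall>X. X \<subseteq> ground M \<longrightarrow> (X \<in> indeps M \<longleftrightarrow> f ` X \<in> indeps N)))"

definition of_circuits :: "'a set \<Rightarrow> 'a set set \<Rightarrow> 'a mat" where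
  "of_circuits E \<C> = \<lparr>ground = E, indeps = {I. I \<subseteq> E \<and> (\<forall>C\<in>\<C>. \<not> C \<subseteq> I)}\<rparr>"

text \<open>The next two operations are only meaningful for \<open>x \<notin> ground M\<close>.\<close>

definition free_extension :: "'a mat \<Rightarrow> 'a \<Rightarrow> 'a mat" where
  "free_extension M x = of_circuits (insert x (ground M)) (circuits M \<union> insert x ` bases M)"

definition free_coextension :: "'a mat \<Rightarrow> 'a \<Rightarrow> 'a mat" where
  "free_coextension M x = dual (free_extension (dual M) x)"

text \<open>
  \<open>obtainable M N\<close>: the matroid \<open>N\<close> arises from \<open>M\<close> by a finite sequence, in any order, of
  minors, free extensions and free coextensions. The element type is assumed infinite wherever
  this is used, so that new elements never run out; up to isomorphism the choice of the new
  element is immaterial.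
\<close>

inductive obtainable :: "'a mat \<Rightarrow> 'a mat \<Rightarrow> bool" for M :: "'a mat" where
  start: "obtainable M M"
| take_minor: "obtainable M N \<Longrightarrow> minor N' N \<Longrightarrow> obtainable M N'"
| extend: "obtainable M N \<Longrightarrow> x \<notin> ground N \<Longrightarrow> obtainable M (free_extension N x)"
| coextend: "obtainable M N \<Longrightarrow> x \<notin> ground N \<Longrightarrow> obtainable M (free_coextension N x)"

definition FI :: "'a mat \<Rightarrow> 'a set" where
  "FI M = {x \<in> ground M. \<forall>F\<in>cyclic_flats M. F \<noteq> ground M \<longrightarrow> x \<notin> F}"

definition has_minor_iso :: "'a mat \<Rightarrow> 'b mat \<Rightarrow> bool" where
  "has_minor_iso M N \<longleftrightarrow> (\<exists>M'. minor M' M \<and> isomorphic M' N)"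

definition intertwine :: "'a mat \<Rightarrow> 'b mat \<Rightarrow> 'c mat \<Rightarrow> bool" where
  "intertwine M N1 N2 \<longleftrightarrow>
     matroid M \<and> has_minor_iso M N1 \<and> has_minor_iso M N2 \<and>
     (\<forall>M'. proper_minor M' M \<longrightarrow> \<not> (has_minor_iso M' N1 \<and> has_minor_iso M' N2))"

text \<open>
  A matroid is determined by its cyclic flats and their ranks, so \<open>M_construction\<close> is the
  unique matroid with the data prescribed by \<open>is_M_construction\<close>. It is only used for
  parameters for which such a matroid exists.
\<close>

definition is_M_construction ::
  "nat \<Rightarrow> 'a mat \<Rightarrow> 'a set \<Rightarrow> 'a set \<Rightarrow> 'a mat \<Rightarrow> 'a set \<Rightarrow> 'a set \<Rightarrow> 'a mat \<Rightarrow> bool" where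
  "is_M_construction k N1 A1 U1 N2 A2 U2 M \<longleftrightarrow>
     matroid M \<and>
     ground M = ground N1 \<union> ground N2 \<union> U1 \<union> U2 \<and>
     cyclic_flats M =
       {{}, ground M} \<union>
       {F \<union> U1 \<union> A2 | F. F \<in> nonempty_proper_cyclic_flats N1} \<union>
       {F \<union> U2 \<union> A1 | F. F \<in> nonempty_proper_cyclic_flats N2} \<and>
     rk M {} = 0 \<and>
     rk M (ground M) = k \<and>
     (\<forall>F\<in>nonempty_proper_cyclic_flats N1. rk M (F \<union> U1 \<union> A2) = rk N1 F + card U1 + card A2) \<and>
     (\<forall>F\<in>nonempty_proper_cyclic_flats N2. rk M (F \<union> U2 \<union> A1) = rk N2 F + card U2 + card A1)"

definition M_construction ::
  "nat \<Rightarrow> 'a mat \<Rightarrow> 'a set \<Rightarrow> 'a set \<Rightarrow> 'a mat \<Rightarrow> 'a set \<Rightarrow> 'a set \<Rightarrow> 'a mat" where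
  "M_construction k N1 A1 U1 N2 A2 U2 = (THE M. is_M_construction k N1 A1 U1 N2 A2 U2 M)"

end

theory Submission
  imports Defs
begin

text \<open>
  Let \<open>Q1\<close> be \<open>M1\<close> freely coextended by \<open>D1 = T1 \<union> S2'\<close> and freely extended by the remaining
  elements \<open>C1\<close>, and define \<open>Q2\<close> in the same way from \<open>M2\<close>. The rank function of \<open>M\<close> is the
  minimum of those of \<open>Q1\<close> and \<open>Q2\<close>. As \<open>k\<close> is large, the two rank functions satisfy a crossing
  inequality, which makes the minimum submodular, and which shows that a minor of \<open>M\<close> isomorphic to
  \<open>M1\<close>, written with an independent contracted set, is already a minor of \<open>Q1\<close> or of \<open>Q2\<close>.
  The latter is impossible, as minors of \<open>Q2\<close> are obtainable from \<open>M2\<close>.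

  The sum of the nullities of the nonempty proper cyclic flats does not increase in minors, and
  drops strictly when an element of such a flat is deleted; it is the same for \<open>Q1\<close> and \<open>M1\<close>.
  Hence only elements of \<open>C1 \<union> FI M1\<close> can be deleted from \<open>Q1\<close> when \<open>M1\<close> is to survive as a minor,
  and by duality only elements of \<open>D1 \<union> FI (dual M1)\<close> can be contracted. By the choice of \<open>S1'\<close>
  and \<open>S2'\<close> no element satisfies such a condition for \<open>M1\<close> and \<open>M2\<close> simultaneously.
\<close>

section \<open>Rank functions\<close>

text \<open>The obstacle is that minors do not commute with the minimum of two rank functions: in a
  minor of M, one function may decide the rank of some sets and the other that of others. Contracted
  sets are therefore replaced by independent ones of size k - r(M1), so large that the crossing
  inequality leaves only one function to decide. The replacement may move elements between the
  contracted and the deleted set. But M has neither loops nor isthmuses, so any single prescribed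
  element can be kept on its side, and the final argument runs element by element. The crossing
  inequality has slack |S1| + |S2|, and comparing minors of rank r(Mi) costs r(Mi) \<le> |Si| more;
  hence the size conditions 2|S1| + |S2| \<le> k and |S1| + 2|S2| \<le> k. Nullities are summed,
  rather than cyclic flats counted, because deleting one element of a cyclic flat may leave the
  number and the ranks of the cyclic flats intact. If M1 had no nonempty proper cyclic flat, FI
  would be everything for both M1 and its dual, which the existence of S1' excludes.\<close>

definition rank_function :: "'a set \<Rightarrow> ('a set \<Rightarrow> nat) \<Rightarrow> bool" where
  "rank_function E f \<longleftrightarrow> finite E \<and> (\<forall>X\<subseteq>E. f X \<le> card X) \<and>
     (\<forall>X Y. X \<subseteq> Y \<longrightarrow> Y \<subseteq> E \<longrightarrow> f X \<le> f Y) \<and>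
     (\<forall>X\<subseteq>E. \<forall>Y\<subseteq>E. f (X \<union> Y) + f (X \<inter> Y) \<le> f X + f Y)"

definition mat_of_rank :: "'a set \<Rightarrow> ('a set \<Rightarrow> nat) \<Rightarrow> 'a mat" where
  "mat_of_rank E f = \<lparr>ground = E, indeps = {X. X \<subseteq> E \<and> f X = card X}\<rparr>"

lemma rank_functionI:
  assumes "finite E" "\<And>X. X \<subseteq> E \<Longrightarrow> f X \<le> card X"
    "\<And>X Y. X \<subseteq> Y \<Longrightarrow> Y \<subseteq> E \<Longrightarrow> f X \<le> f Y"
    "\<And>X Y. X \<subseteq> E \<Longrightarrow> Y \<subseteq> E \<Longrightarrow> f (X \<union> Y) + f (X \<inter> Y) \<le> f X + f Y"
  shows "rank_function E f"
  using assms unfolding rank_function_def by blast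

lemma
  assumes "rank_function E f"
  shows rank_function_finite: "finite E"
    and rank_function_le_card: "X \<subseteq> E \<Longrightarrow> f X \<le> card X"
    and rank_function_mono: "X \<subseteq> Y \<Longrightarrow> Y \<subseteq> E \<Longrightarrow> f X \<le> f Y"
    and rank_function_submod: "X \<subseteq> E \<Longrightarrow> Y \<subseteq> E \<Longrightarrow> f (X \<union> Y) + f (X \<inter> Y) \<le> f X + f Y"
  using assms unfolding rank_function_def by blast+

lemma rank_function_Un_le:
  assumes "rank_function E f" "X \<subseteq> E" "Y \<subseteq> E"
  shows "f (X \<union> Y) \<le> f X + card Y"
  using rank_function_submod[OF assms] rank_function_le_card[OF assms(1,3)] by linarith

lemma rank_function_insert_le:
  assumes "rank_function E f" "X \<subseteq> E" "x \<in> E"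
  shows "f (insert x X) \<le> f X + 1"
  using rank_function_Un_le[OF assms(1,2), of "{x}"] assms(3) by simp

text \<open>Elements are adjoined one at a time: \<open>I \<union> A\<close> and
  \<open>insert a I\<close> meet in \<open>I\<close>, so submodularity leaves no room for the rank
  to grow.\<close>

lemma rank_function_spanned:
  assumes f: "rank_function E f" and "I \<subseteq> E" "A \<subseteq> E"
    and "\<And>x. x \<in> A \<Longrightarrow> f (insert x I) \<le> f I"
  shows "f (I \<union> A) = f I"
proof -
  have "finite A" using assms rank_function_finite finite_subset by metis
  then show ?thesis using assms(3,4)
  proof (induction A)
    case (insert a A)
    have "f ((I \<union> A) \<union> insert a I) + f ((I \<union> A) \<inter> insert a I) \<le> f (I \<union> A) + f (insert a I)"
      by (rule rank_function_submod[OF f]) (use insert.prems assms(2) in auto)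
    moreover have "(I \<union> A) \<union> insert a I = I \<union> insert a A" "(I \<union> A) \<inter> insert a I = I"
      using insert.hyps by auto
    moreover have "f (I \<union> A) = f I" "f (insert a I) \<le> f I" using insert by auto
    moreover have "f I \<le> f (I \<union> insert a A)"
      by (rule rank_function_mono[OF f]) (use insert.prems assms(2) in auto)
    ultimately show ?case by simp
  qed simp
qed

text \<open>Heredity: dropping \<open>X - J\<close> lowers the rank by at most
  \<open>card (X - J)\<close>. Augmentation: if no element of \<open>J - I\<close> could be added,
  \<open>I\<close> would span \<open>J\<close>, whence \<open>f J \<le> f I\<close>, against
  \<open>card I < card J\<close>.\<close>

lemma matroid_mat_of_rank:
  assumes f: "rank_function E f"
  shows "matroid (mat_of_rank E f)"
proof -
  have fin: "finite E" using f rank_function_finite by blast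
  have down: "f J = card J" if "X \<subseteq> E" "f X = card X" "J \<subseteq> X" for X J
  proof -
    have "f (J \<union> (X - J)) \<le> f J + card (X - J)"
      by (rule rank_function_Un_le[OF f]) (use that in auto)
    moreover have "J \<union> (X - J) = X" using that by auto
    moreover have "card X = card J + card (X - J)"
      using that fin by (metis card_Diff_subset card_mono finite_subset le_add_diff_inverse)
    moreover have "f J \<le> card J" using rank_function_le_card[OF f] that by (meson order_trans)
    ultimately show ?thesis using that by simp
  qed
  have aug: "\<exists>x\<in>J - I. f (insert x I) = card (insert x I)"
    if "I \<subseteq> E" "f I = card I" "J \<subseteq> E" "f J = card J" "card I < card J" for I J
  proof (rule ccontr)
    assume neg: "\<not> ?thesis"
    have "f (insert x I) \<le> f I" if x: "x \<in> J - I" for x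
    proof -
      have "f (insert x I) \<le> f I + 1"
        by (rule rank_function_insert_le[OF f]) (use x \<open>I \<subseteq> E\<close> \<open>J \<subseteq> E\<close> in auto)
      moreover have "card (insert x I) = card I + 1"
        using x finite_subset[OF \<open>I \<subseteq> E\<close> fin] by simp
      moreover have "f (insert x I) \<noteq> card (insert x I)" using neg x by blast
      ultimately show ?thesis using \<open>f I = card I\<close> by linarith
    qed
    then have "f (I \<union> (J - I)) = f I"
      by (intro rank_function_spanned[OF f]) (use that in auto)
    moreover have "f J \<le> f (I \<union> (J - I))"
      by (rule rank_function_mono[OF f]) (use that in auto)
    ultimately show False using that by simp
  qed
  have "f {} = 0" using rank_function_le_card[OF f, of "{}"] by simp
  show ?thesis
    unfolding matroid_def
  proof (intro conjI ballI allI impI)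
    fix I J assume "I \<in> indeps (mat_of_rank E f)" "J \<subseteq> I"
    then show "J \<in> indeps (mat_of_rank E f)" using down[of I J] by (auto simp: mat_of_rank_def)
  next
    fix I J assume "I \<in> indeps (mat_of_rank E f)" "J \<in> indeps (mat_of_rank E f)" "card I < card J"
    then show "\<exists>x\<in>J - I. insert x I \<in> indeps (mat_of_rank E f)"
      using aug[of I J] by (auto simp: mat_of_rank_def)
  qed (simp_all add: mat_of_rank_def fin \<open>f {} = 0\<close>)
qed

text \<open>A largest independent \<open>I\<close> inside \<open>X\<close> spans \<open>X\<close>:
  an element raising \<open>f I\<close> would yield a larger independent subset of
  \<open>X\<close>.\<close>

lemma rk_mat_of_rank:
  assumes f: "rank_function E f" and X: "X \<subseteq> E"
  shows "rk (mat_of_rank E f) X = f X"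
proof -
  let ?S = "{I. I \<subseteq> X \<and> f I = card I}"
  have fin: "finite X" using X f rank_function_finite finite_subset by metis
  have finS: "finite ?S" using fin by simp
  have "f {} = 0" using rank_function_le_card[OF f, of "{}"] by simp
  then have "{} \<in> ?S" by simp
  then have ne: "?S \<noteq> {}" by blast
  have eq: "rk (mat_of_rank E f) X = Max (card ` ?S)"
    unfolding rk_def mat_of_rank_def using X by (intro arg_cong[where f = Max]) auto
  obtain I where I: "I \<in> ?S" "card I = Max (card ` ?S)"
  proof -
    have "Max (card ` ?S) \<in> card ` ?S" using finS ne by (intro Max_in) simp_all
    then show ?thesis using that by force
  qed
  have IE: "I \<subseteq> E" "finite I" using I X fin finite_subset by auto
  have "f (insert x I) \<le> f I" if x: "x \<in> X - I" for x
  proof (rule ccontr)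
    assume "\<not> ?thesis"
    moreover have "f (insert x I) \<le> f I + 1"
      by (rule rank_function_insert_le[OF f]) (use IE x X in auto)
    ultimately have "f (insert x I) = card (insert x I)" using I x IE by simp
    then have "card (insert x I) \<le> Max (card ` ?S)" using I x finS by (intro Max_ge) auto
    then show False using I x IE by simp
  qed
  then have "f (I \<union> (X - I)) = f I"
    by (intro rank_function_spanned[OF f]) (use IE X in auto)
  moreover have "I \<union> (X - I) = X" using I by auto
  ultimately show ?thesis using eq I by simp
qed

lemma ground_mat_of_rank [simp]: "ground (mat_of_rank E f) = E"
  by (simp add: mat_of_rank_def)

section \<open>The rank function of a matroid\<close>

lemma
  assumes "matroid M"
  shows matroid_finite: "finite (ground M)"
    and indep_subset_ground: "I \<in> indeps M \<Longrightarrow> I \<subseteq> ground M"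
    and empty_indep: "{} \<in> indeps M"
    and indep_subset: "I \<in> indeps M \<Longrightarrow> J \<subseteq> I \<Longrightarrow> J \<in> indeps M"
    and indep_augment: "I \<in> indeps M \<Longrightarrow> J \<in> indeps M \<Longrightarrow> card I < card J \<Longrightarrow>
      \<exists>x\<in>J - I. insert x I \<in> indeps M"
  using assms unfolding matroid_def by blast+

lemma finite_indeps_below:
  assumes "matroid M"
  shows "finite {I \<in> indeps M. I \<subseteq> X}"
  by (rule finite_subset[of _ "Pow (ground M)"])
    (use indep_subset_ground[OF assms] matroid_finite[OF assms] in blast, simp add: matroid_finite[OF assms])

lemma indep_finite: "matroid M \<Longrightarrow> I \<in> indeps M \<Longrightarrow> finite I"
  using matroid_finite indep_subset_ground finite_subset by metis

lemma card_le_rk: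
  assumes "matroid M" "I \<in> indeps M" "I \<subseteq> X"
  shows "card I \<le> rk M X"
  unfolding rk_def using finite_indeps_below[OF assms(1)] assms by (intro Max_ge) auto

lemma extend_to_rk:
  assumes M: "matroid M" and I: "I \<in> indeps M" "I \<subseteq> X"
  obtains J where "J \<in> indeps M" "I \<subseteq> J" "J \<subseteq> X" "card J = rk M X"
proof -
  let ?S = "{I \<in> indeps M. I \<subseteq> X}"
  have "rk M X \<in> card ` ?S"
    unfolding rk_def using finite_indeps_below[OF M] I by (intro Max_in) auto
  then obtain B where B: "B \<in> indeps M" "B \<subseteq> X" "card B = rk M X" by auto
  let ?T = "{J \<in> indeps M. J \<subseteq> X \<and> I \<subseteq> J}"
  have fin: "finite ?T"
    using finite_indeps_below[OF M] by (rule rev_finite_subset) auto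
  define m where "m = Max (card ` ?T)"
  have "m \<in> card ` ?T" unfolding m_def using fin I by (intro Max_in) auto
  then obtain J where J: "J \<in> ?T" "card J = m" by auto
  have "card J = rk M X"
  proof (rule ccontr)
    assume "card J \<noteq> rk M X"
    then have "card J < card B" using card_le_rk[OF M, of J X] J B by simp
    then obtain x where x: "x \<in> B - J" "insert x J \<in> indeps M"
      using indep_augment[OF M] J B by blast
    then have "card (insert x J) \<le> m" unfolding m_def using J B fin by (intro Max_ge) auto
    then show False using x J indep_finite[OF M, of J] by simp
  qed
  then show ?thesis using J that by blast
qed

lemma rk_le_card:
  assumes "matroid M" "finite X"
  shows "rk M X \<le> card X"
  using extend_to_rk[OF assms(1) empty_indep[OF assms(1)], of X] assms(2)
  by (metis card_mono empty_subsetI)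

lemma rk_indep:
  assumes M: "matroid M" and I: "I \<in> indeps M"
  shows "rk M I = card I"
  using rk_le_card[OF M indep_finite[OF M I]] card_le_rk[OF M I subset_refl] by simp

lemma rk_mono:
  assumes "matroid M" "X \<subseteq> Y"
  shows "rk M X \<le> rk M Y"
  using extend_to_rk[OF assms(1) empty_indep[OF assms(1)], of X] card_le_rk[OF assms(1)] assms(2)
  by (metis empty_subsetI order_trans)

text \<open>Extend a maximum independent subset of the intersection to one of the union; its traces
  on \<open>X\<close> and \<open>Y\<close> are independent, and counting them gives the
  inequality.\<close>

lemma rk_submod:
  assumes M: "matroid M"
  shows "rk M (X \<union> Y) + rk M (X \<inter> Y) \<le> rk M X + rk M Y"
proof -
  obtain A where A: "A \<in> indeps M" "A \<subseteq> X \<inter> Y" "card A = rk M (X \<inter> Y)"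
    using extend_to_rk[OF M empty_indep[OF M], of "X \<inter> Y"] by auto
  obtain B where B: "B \<in> indeps M" "A \<subseteq> B" "B \<subseteq> X \<union> Y" "card B = rk M (X \<union> Y)"
    using extend_to_rk[OF M A(1), of "X \<union> Y"] A by blast
  have fin: "finite B" using indep_finite M B by blast
  have "card (B \<inter> X) + card (B \<inter> Y) = card (B \<inter> X \<union> B \<inter> Y) + card (B \<inter> X \<inter> (B \<inter> Y))"
    using fin by (intro card_Un_Int) auto
  moreover have "B \<inter> X \<union> B \<inter> Y = B" using B by auto
  moreover have "card A \<le> card (B \<inter> X \<inter> (B \<inter> Y))"
    using fin A B by (intro card_mono) auto
  moreover have "card (B \<inter> X) \<le> rk M X" "card (B \<inter> Y) \<le> rk M Y"
    using card_le_rk[OF M indep_subset[OF M B(1)]] by simp_all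
  ultimately show ?thesis using A B by simp
qed

lemma rank_function_rk: "matroid M \<Longrightarrow> rank_function (ground M) (rk M)"
  by (intro rank_functionI)
    (simp_all add: matroid_finite rk_le_card rk_mono rk_submod finite_subset[of _ "ground M"])

lemma rk_Un_le_card: "matroid M \<Longrightarrow> finite Y \<Longrightarrow> rk M (X \<union> Y) \<le> rk M X + card Y"
  using rk_submod[of M X Y] rk_le_card[of M Y] by linarith

lemma rk_insert_le: "matroid M \<Longrightarrow> rk M (insert x X) \<le> rk M X + 1"
  using rk_Un_le_card[of M "{x}" X] by simp

lemma indep_iff_rk:
  assumes M: "matroid M"
  shows "X \<in> indeps M \<longleftrightarrow> X \<subseteq> ground M \<and> rk M X = card X"
proof
  assume "X \<subseteq> ground M \<and> rk M X = card X"
  moreover then have "finite X" using M matroid_finite finite_subset by metis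
  ultimately show "X \<in> indeps M"
    using extend_to_rk[OF M empty_indep[OF M], of X] by (metis card_subset_eq empty_subsetI)
qed (use M rk_indep indep_subset_ground in blast)

lemma matroid_eqI:
  assumes "matroid M" "matroid N" "ground M = ground N"
    "\<And>X. X \<subseteq> ground M \<Longrightarrow> rk M X = rk N X"
  shows "M = N"
  using assms by (intro mat.equality) (auto simp: indep_iff_rk)

lemma rank_le_rk_plus_card_Diff:
  assumes "matroid M" "X \<subseteq> ground M"
  shows "rank M \<le> rk M X + card (ground M - X)"
proof -
  have "X \<union> (ground M - X) = ground M" using assms by auto
  then show ?thesis
    using rk_Un_le_card[of M "ground M - X" X] assms matroid_finite by force
qed

section \<open>Duality and minors\<close>

lemma basis_iff:
  assumes M: "matroid M"
  shows "B \<in> bases M \<longleftrightarrow> B \<in> indeps M \<and> card B = rank M"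
proof
  assume B: "B \<in> bases M"
  then have i: "B \<in> indeps M" by (simp add: bases_def)
  obtain J where "J \<in> indeps M" "B \<subseteq> J" "card J = rank M"
    using extend_to_rk[OF M i indep_subset_ground[OF M i]] by metis
  then show "B \<in> indeps M \<and> card B = rank M" using B by (auto simp: bases_def)
next
  assume B: "B \<in> indeps M \<and> card B = rank M"
  have "I = B" if I: "I \<in> indeps M" "B \<subseteq> I" for I
  proof -
    have "card I \<le> card B" using card_le_rk[OF M I(1) indep_subset_ground[OF M I(1)]] B by simp
    then show ?thesis using indep_finite[OF M I(1)] I(2) by (metis card_seteq)
  qed
  then show "B \<in> bases M" using B by (simp add: bases_def)
qed

lemma rank_function_dual:
  assumes M: "matroid M"
  shows "rank_function (ground M) (\<lambda>X. card X + rk M (ground M - X) - rank M)"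
proof (rule rank_functionI)
  let ?E = "ground M"
  have fin: "finite ?E" using M matroid_finite by blast
  \<comment> \<open>The subtraction in the dual rank is truncated; this bound makes it
    exact.\<close>
  have le: "rank M \<le> card X + rk M (?E - X)" if "X \<subseteq> ?E" for X
    using rank_le_rk_plus_card_Diff[OF M, of "?E - X"] that by (simp add: double_diff)
  show "finite ?E" by fact
  show "card X + rk M (?E - X) - rank M \<le> card X" for X
    using rk_mono[OF M, of "?E - X" ?E] by simp
  show "card X + rk M (?E - X) - rank M \<le> card Y + rk M (?E - Y) - rank M"
    if "X \<subseteq> Y" "Y \<subseteq> ?E" for X Y
  proof -
    have "?E - X = (?E - Y) \<union> (Y - X)" using that by auto
    then have "rk M (?E - X) \<le> rk M (?E - Y) + card (Y - X)"
      using rk_Un_le_card[OF M, of "Y - X"] fin that by (metis finite_Diff finite_subset)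
    moreover have "card Y = card X + card (Y - X)"
      using that fin by (metis card_Diff_subset card_mono finite_subset le_add_diff_inverse)
    ultimately show ?thesis by simp
  qed
  show "card (X \<union> Y) + rk M (?E - (X \<union> Y)) - rank M + (card (X \<inter> Y) + rk M (?E - X \<inter> Y) - rank M)
      \<le> card X + rk M (?E - X) - rank M + (card Y + rk M (?E - Y) - rank M)"
    if "X \<subseteq> ?E" "Y \<subseteq> ?E" for X Y
  proof -
    have "?E - (X \<union> Y) = (?E - X) \<inter> (?E - Y)" "?E - X \<inter> Y = (?E - X) \<union> (?E - Y)" by auto
    then have "rk M (?E - X \<inter> Y) + rk M (?E - (X \<union> Y)) \<le> rk M (?E - X) + rk M (?E - Y)"
      using rk_submod[OF M] by metis
    moreover have "card X + card Y = card (X \<union> Y) + card (X \<inter> Y)"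
      using that fin by (metis card_Un_Int finite_subset)
    moreover have "X \<union> Y \<subseteq> ?E" "X \<inter> Y \<subseteq> ?E" using that by auto
    ultimately show ?thesis using le[of X] le[of Y] le[of "X \<union> Y"] le[of "X \<inter> Y"] that by linarith
  qed
qed

text \<open>A set misses some basis exactly when its complement still has full rank, that is, when
  its dual rank equals its size.\<close>

lemma dual_eq_mat_of_rank:
  assumes M: "matroid M"
  shows "dual M = mat_of_rank (ground M) (\<lambda>X. card X + rk M (ground M - X) - rank M)"
proof -
  let ?E = "ground M"
  have "(\<exists>B\<in>bases M. I \<inter> B = {}) \<longleftrightarrow> card I + rk M (?E - I) - rank M = card I"
    if I: "I \<subseteq> ?E" for I
  proof -
    have "finite I" using I M matroid_finite finite_subset by metis
    then have "card I + rk M (?E - I) - rank M = card I \<longleftrightarrow> rk M (?E - I) = rank M"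
      using rk_mono[OF M, of "?E - I" ?E] rank_le_rk_plus_card_Diff[OF M, of "?E - I"] I
      by (auto simp: double_diff)
    also have "\<dots> \<longleftrightarrow> (\<exists>B\<in>bases M. I \<inter> B = {})"
    proof
      assume eq: "rk M (?E - I) = rank M"
      obtain J where J: "J \<in> indeps M" "J \<subseteq> ?E - I" "card J = rk M (?E - I)"
        by (rule extend_to_rk[OF M empty_indep[OF M], of "?E - I"]) simp_all
      then have "J \<in> bases M" "I \<inter> J = {}" using eq by (auto simp: basis_iff[OF M])
      then show "\<exists>B\<in>bases M. I \<inter> B = {}" by blast
    next
      assume "\<exists>B\<in>bases M. I \<inter> B = {}"
      then obtain B where B: "B \<in> indeps M" "card B = rank M" "I \<inter> B = {}"
        by (auto simp: basis_iff[OF M])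
      then have "rank M \<le> rk M (?E - I)"
        using card_le_rk[OF M B(1), of "?E - I"] indep_subset_ground[OF M B(1)] by auto
      then show "rk M (?E - I) = rank M" using rk_mono[OF M, of "?E - I" ?E] by simp
    qed
    finally show ?thesis by simp
  qed
  then show ?thesis by (auto simp: dual_def mat_of_rank_def)
qed

lemma ground_dual [simp]: "ground (dual M) = ground M"
  by (simp add: dual_def)

lemma matroid_dual: "matroid M \<Longrightarrow> matroid (dual M)"
  by (simp add: dual_eq_mat_of_rank rank_function_dual matroid_mat_of_rank)

text \<open>Additive form, so that linear arithmetic can use it without meeting truncated
  subtraction; the formulas for contractions and minors follow the same pattern.\<close>

lemma rk_dual:
  assumes "matroid M" "X \<subseteq> ground M"
  shows "rk (dual M) X + rank M = card X + rk M (ground M - X)"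
  using assms rank_le_rk_plus_card_Diff[of M "ground M - X"]
  by (simp add: dual_eq_mat_of_rank rank_function_dual rk_mat_of_rank double_diff)

lemma dual_dual:
  assumes M: "matroid M"
  shows "dual (dual M) = M"
proof (rule matroid_eqI)
  fix X assume X: "X \<subseteq> ground (dual (dual M))"
  let ?E = "ground M"
  have "rk (dual (dual M)) X + rk (dual M) ?E = card X + rk (dual M) (?E - X)"
    using rk_dual[OF matroid_dual[OF M], of X] X by simp
  moreover have "rk (dual M) ?E + rank M = card ?E + rk M {}"
    using rk_dual[OF M, of ?E] by simp
  moreover have "rk (dual M) (?E - X) + rank M = card (?E - X) + rk M X"
    using rk_dual[OF M, of "?E - X"] X by (simp add: double_diff)
  moreover have "rk M {} = 0" using rk_le_card[OF M, of "{}"] by simp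
  moreover have "card ?E = card X + card (?E - X)"
    using X matroid_finite[OF M] by (metis card_Diff_subset card_mono finite_subset ground_dual le_add_diff_inverse)
  ultimately show "rk (dual (dual M)) X = rk M X" by simp
qed (simp_all add: M matroid_dual)

section \<open>Deletion, contraction and their ranks\<close>

lemma ground_delete [simp]: "ground (delete M Y) = ground M - Y"
  by (simp add: delete_def)

lemma ground_contract [simp]: "ground (contract M X) = ground M - X"
  by (simp add: contract_def)

lemma matroid_delete:
  assumes M: "matroid M"
  shows "matroid (delete M Y)"
proof -
  have "\<exists>x\<in>J - I. insert x I \<in> indeps M \<and> insert x I \<inter> Y = {}"
    if "I \<in> indeps M" "I \<inter> Y = {}" "J \<in> indeps M" "J \<inter> Y = {}" "card I < card J" for I J
    using indep_augment[OF M that(1,3,5)] that(2,4) by blast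
  moreover have "J \<in> indeps M" if "I \<in> indeps M" "J \<subseteq> I" for I J
    using indep_subset[OF M] that by blast
  ultimately show ?thesis
    unfolding matroid_def delete_def
    using matroid_finite[OF M] indep_subset_ground[OF M] empty_indep[OF M] by simp blast
qed

lemma rk_delete: "X \<inter> Y = {} \<Longrightarrow> rk (delete M Y) X = rk M X"
  unfolding rk_def delete_def by (intro arg_cong[where f = Max]) auto

lemma matroid_contract: "matroid M \<Longrightarrow> matroid (contract M X)"
  by (simp add: contract_def matroid_delete matroid_dual)

lemma rk_contract:
  assumes M: "matroid M" and X: "X \<subseteq> ground M" and Z: "Z \<subseteq> ground M - X"
  shows "rk (contract M X) Z + rk M X = rk M (Z \<union> X)"
proof -
  let ?E = "ground M"
  let ?D = "delete (dual M) X"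
  have D: "matroid ?D" using M by (simp add: matroid_delete matroid_dual)
  have "rk (contract M X) Z + rk ?D (?E - X) = card Z + rk ?D (?E - X - Z)"
    using rk_dual[OF D, of Z] Z by (simp add: contract_def)
  moreover have "rk ?D (?E - X) = rk (dual M) (?E - X)" "rk ?D (?E - X - Z) = rk (dual M) (?E - X - Z)"
    by (rule rk_delete, blast)+
  moreover have "rk (dual M) (?E - X) + rank M = card (?E - X) + rk M X"
    using rk_dual[OF M, of "?E - X"] X by (simp add: double_diff)
  moreover have "rk (dual M) (?E - X - Z) + rank M = card (?E - X - Z) + rk M (Z \<union> X)"
  proof -
    have "?E - (?E - X - Z) = Z \<union> X" using X Z by auto
    then show ?thesis using rk_dual[OF M, of "?E - X - Z"] by auto
  qed
  moreover have "card (?E - X) = card Z + card (?E - X - Z)"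
    using Z matroid_finite[OF M] by (metis card_Diff_subset card_mono finite_Diff finite_subset le_add_diff_inverse)
  ultimately show ?thesis by simp
qed

lemma rk_minor:
  assumes M: "matroid M" and X: "X \<subseteq> ground M" and Z: "Z \<subseteq> ground M - X - Y"
  shows "rk (delete (contract M X) Y) Z + rk M X = rk M (Z \<union> X)"
proof -
  have "rk (delete (contract M X) Y) Z = rk (contract M X) Z"
    using Z by (intro rk_delete) blast
  then show ?thesis using rk_contract[OF M X, of Z] Z by auto
qed

lemma matroid_minor: "matroid M \<Longrightarrow> matroid (delete (contract M X) Y)"
  by (simp add: matroid_contract matroid_delete)

text \<open>Independence of \<open>X\<close> turns the rank difference into a difference of
  cardinalities. For dependent \<open>X\<close> the right-hand side would always be false.\<close>

lemma indep_minor: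
  assumes M: "matroid M" and X: "X \<in> indeps M"
  shows "Z \<in> indeps (delete (contract M X) Y) \<longleftrightarrow> Z \<subseteq> ground M - X - Y \<and> Z \<union> X \<in> indeps M"
proof (cases "Z \<subseteq> ground M - X - Y")
  case True
  have XE: "X \<subseteq> ground M" using indep_subset_ground[OF M X] .
  have "finite Z" "finite X" using True XE matroid_finite[OF M] by (meson Diff_subset finite_subset order_trans)+
  then have "card (Z \<union> X) = card Z + card X" using True by (intro card_Un_disjoint) auto
  moreover have "Z \<subseteq> ground (delete (contract M X) Y)" using True by simp
  moreover have "Z \<union> X \<subseteq> ground M" using True XE by blast
  ultimately show ?thesis
    using rk_minor[OF M XE True] rk_indep[OF M X] True
    by (auto simp: indep_iff_rk[OF M] indep_iff_rk[OF matroid_minor[OF M]])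
qed (use indep_subset_ground[OF matroid_minor[OF M], of Z X Y] in auto)

lemma delete_contract_commute:
  assumes M: "matroid M" and XY: "X \<subseteq> ground M" "X \<inter> Y = {}"
  shows "delete (contract M X) Y = contract (delete M Y) X"
proof (rule matroid_eqI)
  fix Z assume "Z \<subseteq> ground (delete (contract M X) Y)"
  then have Z: "Z \<subseteq> ground M - X - Y" by simp
  have "rk (contract (delete M Y) X) Z + rk (delete M Y) X = rk (delete M Y) (Z \<union> X)"
    by (rule rk_contract) (use Z XY matroid_delete[OF M] in auto)
  moreover have "rk (delete M Y) X = rk M X" "rk (delete M Y) (Z \<union> X) = rk M (Z \<union> X)"
    by (rule rk_delete; use Z XY in blast)+
  ultimately show "rk (delete (contract M X) Y) Z = rk (contract (delete M Y) X) Z"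
    using rk_minor[OF M XY(1) Z] by simp
qed (use M in \<open>auto simp: matroid_minor matroid_contract matroid_delete\<close>)

lemma dual_minor: "dual (delete (contract M X) Y) = contract (delete (dual M) X) Y"
  by (simp add: contract_def)

lemma minor_of_minor:
  assumes M: "matroid M" and XY: "X \<subseteq> ground M"
    and VW: "V \<subseteq> ground M - X - Y" "W \<subseteq> ground M - X - Y"
  shows "delete (contract (delete (contract M X) Y) V) W = delete (contract M (X \<union> V)) (Y \<union> W)"
proof (rule matroid_eqI)
  let ?N = "delete (contract M X) Y"
  have N: "matroid ?N" by (rule matroid_minor[OF M])
  fix Z assume "Z \<subseteq> ground (delete (contract ?N V) W)"
  then have Z: "Z \<subseteq> ground M - X - Y - V - W" by simp
  have "rk (delete (contract ?N V) W) Z + rk ?N V = rk ?N (Z \<union> V)"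
    by (rule rk_minor[OF N]) (use XY VW Z in auto)
  moreover have "rk ?N V + rk M X = rk M (V \<union> X)"
    by (rule rk_minor[OF M]) (use XY VW Z in auto)
  moreover have "rk ?N (Z \<union> V) + rk M X = rk M (Z \<union> V \<union> X)"
    by (rule rk_minor[OF M]) (use XY VW Z in auto)
  moreover have "rk (delete (contract M (X \<union> V)) (Y \<union> W)) Z + rk M (X \<union> V) = rk M (Z \<union> (X \<union> V))"
    by (rule rk_minor[OF M]) (use XY VW Z in auto)
  moreover have "V \<union> X = X \<union> V" "Z \<union> V \<union> X = Z \<union> (X \<union> V)" by auto
  ultimately show "rk (delete (contract ?N V) W) Z = rk (delete (contract M (X \<union> V)) (Y \<union> W)) Z" by simp
qed (use M in \<open>auto simp: matroid_minor\<close>)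

text \<open>Extend \<open>A\<close> to a maximum independent subset \<open>J\<close> of
  \<open>X\<close>, then to a basis \<open>K\<close> of \<open>G \<union> J\<close>, then to a basis
  \<open>L\<close> of \<open>M\<close> avoiding \<open>B\<close>. After contracting \<open>J\<close>
  the rest of \<open>X\<close> consists of loops and may be deleted instead; after deleting
  \<open>Y - L\<close> the elements of \<open>W = L \<inter> Y\<close> are isthmuses and may be
  contracted instead. Through \<open>A\<close> and \<open>B\<close>, prescribed elements stay on
  their side.\<close>

lemma minor_normal_form:
  assumes M: "matroid M" and XY: "X \<subseteq> ground M" "Y \<subseteq> ground M" "X \<inter> Y = {}"
    and A: "A \<subseteq> X" "A \<in> indeps M" and B: "B \<subseteq> Y" "rk M (ground M - B) = rank M"
  obtains X' Y' where "X' \<union> Y' = X \<union> Y" "X' \<inter> Y' = {}" "A \<subseteq> X'" "B \<subseteq> Y'" "X' \<in> indeps M"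
    "card X' + rank (delete (contract M X) Y) = rank M"
    "delete (contract M X') Y' = delete (contract M X) Y"
proof -
  let ?E = "ground M" and ?N = "delete (contract M X) Y"
  define G where "G = ?E - X - Y"
  obtain J where J: "J \<in> indeps M" "A \<subseteq> J" "J \<subseteq> X" "card J = rk M X"
    using extend_to_rk[OF M A(2,1)] .
  obtain K where K: "K \<in> indeps M" "J \<subseteq> K" "K \<subseteq> G \<union> J" "card K = rk M (G \<union> J)"
    using extend_to_rk[OF M J(1), of "G \<union> J"] by blast
  have "K \<subseteq> ?E - B" using K(3) J(3) XY B(1) unfolding G_def by blast
  then obtain L where L: "L \<in> indeps M" "K \<subseteq> L" "L \<subseteq> ?E - B" "card L = rank M"
    using extend_to_rk[OF M K(1), of "?E - B"] B(2) by auto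
  define W where "W = L \<inter> Y"
  have finL: "finite L" using indep_finite[OF M L(1)] .
  have LX: "L \<inter> X = J"
  proof -
    have "card (L \<inter> X) \<le> card J"
      using card_le_rk[OF M indep_subset[OF M L(1)], of "L \<inter> X" X] J(4) by simp
    then show ?thesis using J K L finL by (intro card_seteq[symmetric]) auto
  qed
  have L_split: "L = L \<inter> (G \<union> J) \<union> W"
    using LX indep_subset_ground[OF M L(1)] unfolding W_def G_def by blast
  have JW: "card (J \<union> W) = card J + card W"
    using J XY finL LX unfolding W_def by (intro card_Un_disjoint) (auto intro: finite_subset)
  have "card (K \<union> W) = card K + card W"
    using K(3) J(3) XY finL L(2) unfolding W_def G_def
    by (intro card_Un_disjoint) (auto intro: finite_subset)
  moreover have "card (K \<union> W) \<le> card L"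
    using finL L(2) unfolding W_def by (intro card_mono) auto
  moreover have "card L \<le> card (L \<inter> (G \<union> J)) + card W"
    using L_split card_Un_le by metis
  moreover have "card (L \<inter> (G \<union> J)) \<le> rk M (G \<union> J)"
    using card_le_rk[OF M indep_subset[OF M L(1)], of "L \<inter> (G \<union> J)"] by simp
  ultimately have card_L: "card L = rk M (G \<union> J) + card W" using K(4) by linarith
  have rk_J: "rk M J = card J" using rk_indep[OF M J(1)] .
  \<comment> \<open>\<open>J\<close> spans \<open>X\<close>, so contracting \<open>J\<close> has the
    same effect on ranks as contracting \<open>X\<close>.\<close>
  have span: "rk M (Z \<union> X) = rk M (Z \<union> J)" for Z
  proof -
    have "rk M (Z \<union> J \<union> X) + rk M ((Z \<union> J) \<inter> X) \<le> rk M (Z \<union> J) + rk M X" by (rule rk_submod[OF M])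
    moreover have "Z \<union> J \<union> X = Z \<union> X" using J(3) by blast
    moreover have "rk M J \<le> rk M ((Z \<union> J) \<inter> X)" using J(3) by (intro rk_mono[OF M]) blast
    moreover have "rk M (Z \<union> J) \<le> rk M (Z \<union> X)" using J(3) by (intro rk_mono[OF M]) blast
    ultimately show ?thesis using J(4) rk_J by simp
  qed
  \<comment> \<open>Every element of \<open>W\<close> raises the rank of \<open>G \<union> J\<close>
    by one, and by submodularity also that of any smaller \<open>Z \<union> J\<close>. The
    additional contraction of \<open>W\<close> thus shifts all ranks by the same constant.\<close>
  have add_W: "rk M (Z \<union> (J \<union> W)) = rk M (Z \<union> J) + card W" if "Z \<subseteq> G" for Z
  proof (rule antisym)
    have "finite W" using finL unfolding W_def by blast
    then show "rk M (Z \<union> (J \<union> W)) \<le> rk M (Z \<union> J) + card W"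
      using rk_Un_le_card[OF M, of W "Z \<union> J"] by (simp add: Un_assoc)
    have "rk M ((Z \<union> (J \<union> W)) \<union> (G \<union> J)) + rk M ((Z \<union> (J \<union> W)) \<inter> (G \<union> J)) \<le>
        rk M (Z \<union> (J \<union> W)) + rk M (G \<union> J)"
      by (rule rk_submod[OF M])
    moreover have "rk M (Z \<union> J) \<le> rk M ((Z \<union> (J \<union> W)) \<inter> (G \<union> J))"
      using that by (intro rk_mono[OF M]) blast
    moreover have "card L \<le> rk M ((Z \<union> (J \<union> W)) \<union> (G \<union> J))"
      by (rule card_le_rk[OF M L(1)]) (use L_split in blast)
    ultimately show "rk M (Z \<union> J) + card W \<le> rk M (Z \<union> (J \<union> W))"
      using card_L by linarith
  qed
  define X' Y' where "X' = J \<union> W" and "Y' = X \<union> Y - X'"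
  have X': "X' \<subseteq> X \<union> Y" "X' \<subseteq> L" using J LX unfolding X'_def W_def by auto
  then have X'i: "X' \<in> indeps M" using indep_subset[OF M L(1)] by blast
  have "rank ?N + rk M X = rk M (G \<union> X)"
    using rk_minor[OF M XY(1), of G Y] by (simp add: G_def)
  then have rankN: "rank ?N + card J = rk M (G \<union> J)" using span J(4) by simp
  show thesis
  proof (rule that)
    show "X' \<union> Y' = X \<union> Y" "X' \<inter> Y' = {}" using X' unfolding Y'_def by auto
    show "A \<subseteq> X'" using J unfolding X'_def by blast
    show "B \<subseteq> Y'" using B(1) L(3) X'(2) unfolding Y'_def by blast
    show "X' \<in> indeps M" by fact
    show "card X' + rank ?N = rank M" using rankN card_L L(4) JW unfolding X'_def by simp
    show "delete (contract M X') Y' = ?N"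
    proof (rule matroid_eqI)
      show g: "ground (delete (contract M X') Y') = ground ?N" using X' unfolding Y'_def by auto
      fix Z assume Z: "Z \<subseteq> ground (delete (contract M X') Y')"
      then have ZG: "Z \<subseteq> G" unfolding g G_def by simp
      have "rk (delete (contract M X') Y') Z + rk M X' = rk M (Z \<union> X')"
        by (rule rk_minor[OF M]) (use Z X' XY in auto)
      moreover have "rk ?N Z + rk M X = rk M (Z \<union> X)"
        by (rule rk_minor[OF M XY(1)]) (use ZG in \<open>auto simp: G_def\<close>)
      ultimately show "rk (delete (contract M X') Y') Z = rk ?N Z"
        using span add_W[OF ZG] add_W[of "{}"] rk_J J(4) unfolding X'_def by simp
    qed (simp_all add: matroid_minor M)
  qed
qed

section \<open>Cyclic flats\<close>

lemma dependent_contains_circuit: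
  assumes M: "matroid M" and X: "X \<subseteq> ground M" "X \<notin> indeps M"
  obtains C where "C \<in> circuits M" "C \<subseteq> X"
proof -
  have "\<exists>C. (C \<subseteq> X \<and> C \<notin> indeps M) \<and> (\<forall>D. D \<subseteq> X \<and> D \<notin> indeps M \<longrightarrow> card C \<le> card D)"
    using ex_has_least_nat[of "\<lambda>C. C \<subseteq> X \<and> C \<notin> indeps M" X card] X by blast
  then obtain C where C: "C \<subseteq> X" "C \<notin> indeps M"
    and min: "\<And>D. D \<subseteq> X \<Longrightarrow> D \<notin> indeps M \<Longrightarrow> card C \<le> card D" by blast
  have "finite C" using C X matroid_finite[OF M] by (meson finite_subset)
  then have "D \<in> indeps M" if "D \<subset> C" for D
    using min[of D] C that psubset_card_mono[of C D] by fastforce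
  then have "C \<in> circuits M" using C X unfolding circuits_def by blast
  then show thesis using that C by blast
qed

lemma rk_circuit_remove:
  assumes M: "matroid M" and C: "C \<in> circuits M" and x: "x \<in> C"
  shows "rk M (C - {x}) = rk M C"
proof -
  have "C \<subseteq> ground M" using C unfolding circuits_def by blast
  then have fin: "finite C" using matroid_finite[OF M] finite_subset by blast
  have "C - {x} \<in> indeps M" using C x unfolding circuits_def by blast
  then have "rk M (C - {x}) = card (C - {x})" by (rule rk_indep[OF M])
  moreover have "rk M C \<noteq> card C" using C M unfolding circuits_def by (auto simp: indep_iff_rk)
  moreover have "rk M C \<le> card C" using rk_le_card[OF M fin] .
  moreover have "rk M (C - {x}) \<le> rk M C" by (rule rk_mono[OF M]) blast
  moreover have "card C = card (C - {x}) + 1" using fin x by (metis Suc_eq_plus1 card_Suc_Diff1)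
  ultimately show ?thesis by linarith
qed

lemma rk_remove_superset:
  assumes M: "matroid M" and "C \<subseteq> F" "x \<in> C" "rk M (C - {x}) = rk M C"
  shows "rk M (F - {x}) = rk M F"
proof -
  have "rk M ((F - {x}) \<union> C) + rk M ((F - {x}) \<inter> C) \<le> rk M (F - {x}) + rk M C"
    by (rule rk_submod[OF M])
  moreover have "(F - {x}) \<union> C = F" "(F - {x}) \<inter> C = C - {x}" using assms by auto
  moreover have "rk M (F - {x}) \<le> rk M F" by (rule rk_mono[OF M]) blast
  ultimately show ?thesis using assms(4) by simp
qed

lemma rk_less_insert_subset:
  assumes M: "matroid M" and "F \<subseteq> G" "x \<notin> G" "rk M G < rk M (insert x G)"
  shows "rk M F < rk M (insert x F)"
proof -
  have "rk M (G \<union> insert x F) + rk M (G \<inter> insert x F) \<le> rk M G + rk M (insert x F)"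
    by (rule rk_submod[OF M])
  moreover have "G \<union> insert x F = insert x G" "G \<inter> insert x F = F" using assms by auto
  ultimately show ?thesis using assms(4) by simp
qed

text \<open>A set is a union of circuits iff its restriction has no isthmus. If removing
  \<open>x\<close> keeps the rank, a basis \<open>J\<close> of \<open>F - {x}\<close> together with
  \<open>x\<close> is dependent, and the circuit it contains must pass through \<open>x\<close>.
  From here on only ranks are used.\<close>

lemma cyclic_flats_iff:
  assumes M: "matroid M"
  shows "F \<in> cyclic_flats M \<longleftrightarrow> F \<subseteq> ground M \<and>
    (\<forall>x\<in>ground M - F. rk M F < rk M (insert x F)) \<and> (\<forall>x\<in>F. rk M (F - {x}) = rk M F)"
proof -
  have "(\<exists>\<C>\<subseteq>circuits M. F = \<Union>\<C>) \<longleftrightarrow> (\<forall>x\<in>F. rk M (F - {x}) = rk M F)"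
    if F: "F \<subseteq> ground M"
  proof
    assume "\<exists>\<C>\<subseteq>circuits M. F = \<Union>\<C>"
    then obtain \<C> where \<C>: "\<C> \<subseteq> circuits M" "F = \<Union>\<C>" by blast
    show "\<forall>x\<in>F. rk M (F - {x}) = rk M F"
    proof
      fix x assume "x \<in> F"
      then obtain C where "C \<in> \<C>" "x \<in> C" using \<C> by blast
      then show "rk M (F - {x}) = rk M F"
        using \<C> rk_remove_superset[OF M, of C F x] rk_circuit_remove[OF M, of C x] by blast
    qed
  next
    assume cyc: "\<forall>x\<in>F. rk M (F - {x}) = rk M F"
    have "\<exists>C\<in>circuits M. x \<in> C \<and> C \<subseteq> F" if x: "x \<in> F" for x
    proof -
      obtain J where J: "J \<in> indeps M" "J \<subseteq> F - {x}" "card J = rk M (F - {x})"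
        by (rule extend_to_rk[OF M empty_indep[OF M], of "F - {x}"]) simp_all
      have "insert x J \<notin> indeps M"
      proof
        assume "insert x J \<in> indeps M"
        then have "card (insert x J) \<le> rk M F" using J x by (intro card_le_rk[OF M]) auto
        moreover have "card (insert x J) = card J + 1"
          using indep_finite[OF M J(1)] J(2) by (subst card_insert_disjoint) auto
        ultimately show False using J(3) cyc x by simp
      qed
      then obtain C where C: "C \<in> circuits M" "C \<subseteq> insert x J"
        using dependent_contains_circuit[OF M, of "insert x J"] J F x by blast
      have "x \<in> C"
      proof (rule ccontr)
        assume "x \<notin> C"
        then have "C \<in> indeps M" using C indep_subset[OF M J(1), of C] by blast
        then show False using C unfolding circuits_def by blast
      qed
      then show ?thesis using C J x by blast
    qed
    then have "F = \<Union>{C \<in> circuits M. C \<subseteq> F}" by blast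
    then show "\<exists>\<C>\<subseteq>circuits M. F = \<Union>\<C>" by (intro exI[of _ "{C \<in> circuits M. C \<subseteq> F}"]) blast
  qed
  then show ?thesis unfolding cyclic_flats_def flat_def by blast
qed

lemma nonempty_proper_cyclic_flats_iff:
  assumes M: "matroid M"
  shows "F \<in> nonempty_proper_cyclic_flats M \<longleftrightarrow> F \<noteq> {} \<and> F \<noteq> ground M \<and> F \<subseteq> ground M \<and>
    (\<forall>x\<in>ground M - F. rk M F < rk M (insert x F)) \<and> (\<forall>x\<in>F. rk M (F - {x}) = rk M F)"
  unfolding nonempty_proper_cyclic_flats_def mem_Collect_eq cyclic_flats_iff[OF M] by blast

lemma finite_nonempty_proper_cyclic_flats:
  assumes M: "matroid M"
  shows "finite (nonempty_proper_cyclic_flats M)"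
  by (rule finite_subset[of _ "Pow (ground M)"])
    (auto simp: nonempty_proper_cyclic_flats_def cyclic_flats_def flat_def matroid_finite[OF M])

text \<open>The closure of a set without isthmuses has none either: an added element is spanned by
  \<open>G\<close>, which survives its removal.\<close>

lemma cyclic_flat_hull:
  assumes M: "matroid M" and G: "G \<subseteq> ground M" "\<And>x. x \<in> G \<Longrightarrow> rk M (G - {x}) = rk M G"
  obtains F where "F \<in> cyclic_flats M" "G \<subseteq> F" "rk M F = rk M G"
proof -
  define F where "F = {x \<in> ground M. rk M (insert x G) \<le> rk M G}"
  have GF: "G \<subseteq> F" using G unfolding F_def by (auto simp: insert_absorb)
  have "rk M (G \<union> F) = rk M G"
    by (rule rank_function_spanned[OF rank_function_rk[OF M]]) (use G in \<open>auto simp: F_def\<close>)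
  moreover have "G \<union> F = F" using GF by blast
  ultimately have rkF: "rk M F = rk M G" by simp
  have "rk M F < rk M (insert x F)" if x: "x \<in> ground M - F" for x
  proof -
    have "rk M G < rk M (insert x G)" using x unfolding F_def by auto
    moreover have "rk M (insert x G) \<le> rk M (insert x F)" by (rule rk_mono[OF M]) (use GF in blast)
    ultimately show ?thesis using rkF by simp
  qed
  moreover have "rk M (F - {x}) = rk M F" if x: "x \<in> F" for x
  proof (cases "x \<in> G")
    case True
    then show ?thesis using rk_remove_superset[OF M GF] G(2) by blast
  next
    case False
    then have "rk M G \<le> rk M (F - {x})" using GF by (intro rk_mono[OF M]) blast
    moreover have "rk M (F - {x}) \<le> rk M F" by (rule rk_mono[OF M]) blast
    ultimately show ?thesis using rkF by simp
  qed
  moreover have "F \<subseteq> ground M" unfolding F_def by blast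
  ultimately have "F \<in> cyclic_flats M" by (auto simp: cyclic_flats_iff[OF M])
  then show thesis using that GF rkF by blast
qed

text \<open>A dependent set contains a circuit, whose closure is a cyclic flat of smaller rank than
  the circuit has elements. So cyclic flats with their ranks determine the matroid.\<close>

lemma indep_iff_cyclic_flats:
  assumes M: "matroid M"
  shows "X \<in> indeps M \<longleftrightarrow> X \<subseteq> ground M \<and> (\<forall>F\<in>cyclic_flats M. card (X \<inter> F) \<le> rk M F)"
proof
  assume X: "X \<in> indeps M"
  have "card (X \<inter> F) \<le> rk M F" for F
    using card_le_rk[OF M indep_subset[OF M X], of "X \<inter> F" F] by simp
  then show "X \<subseteq> ground M \<and> (\<forall>F\<in>cyclic_flats M. card (X \<inter> F) \<le> rk M F)"
    using indep_subset_ground[OF M X] by blast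
next
  assume X: "X \<subseteq> ground M \<and> (\<forall>F\<in>cyclic_flats M. card (X \<inter> F) \<le> rk M F)"
  show "X \<in> indeps M"
  proof (rule ccontr)
    assume "X \<notin> indeps M"
    then obtain C where C: "C \<in> circuits M" "C \<subseteq> X"
      using dependent_contains_circuit[OF M, of X] X by blast
    have CE: "C \<subseteq> ground M" using C X by blast
    obtain F where F: "F \<in> cyclic_flats M" "C \<subseteq> F" "rk M F = rk M C"
      using cyclic_flat_hull[OF M CE rk_circuit_remove[OF M C(1)]] by blast
    have "finite X" using X matroid_finite[OF M] finite_subset by blast
    then have "card C \<le> card (X \<inter> F)" using C F by (intro card_mono) auto
    then have "card C \<le> rk M C" using X F by fastforce
    moreover have "rk M C \<le> card C" using C \<open>finite X\<close> by (intro rk_le_card[OF M]) (auto intro: finite_subset)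
    ultimately show False using C M CE unfolding circuits_def by (auto simp: indep_iff_rk)
  qed
qed

lemma matroid_eqI_cyclic_flats:
  assumes M: "matroid M" and N: "matroid N" and "ground M = ground N"
    and "cyclic_flats M = cyclic_flats N" and "\<And>F. F \<in> cyclic_flats M \<Longrightarrow> rk M F = rk N F"
  shows "M = N"
  using assms by (intro mat.equality) (auto simp: indep_iff_cyclic_flats[OF M] indep_iff_cyclic_flats[OF N])

text \<open>Under complementation the two rank conditions change places: a rank increase on adding
  \<open>x\<close> becomes, in the dual, no rank loss on removing \<open>x\<close>, and
  conversely.\<close>

lemma nonempty_proper_cyclic_flats_dual:
  assumes M: "matroid M" and F: "F \<in> nonempty_proper_cyclic_flats M"
  shows "ground M - F \<in> nonempty_proper_cyclic_flats (dual M)"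
proof -
  let ?E = "ground M"
  have F': "F \<noteq> {}" "F \<noteq> ?E" "F \<subseteq> ?E" "\<And>x. x \<in> ?E - F \<Longrightarrow> rk M F < rk M (insert x F)"
    "\<And>x. x \<in> F \<Longrightarrow> rk M (F - {x}) = rk M F"
    using F by (auto simp: nonempty_proper_cyclic_flats_iff[OF M])
  have fin: "finite (?E - F)" using matroid_finite[OF M] by blast
  have rk0: "rk (dual M) (?E - F) + rank M = card (?E - F) + rk M F"
    using rk_dual[OF M, of "?E - F"] F' by (simp add: double_diff)
  have "rk (dual M) (?E - F) < rk (dual M) (insert x (?E - F))" if x: "x \<in> F" for x
  proof -
    have "insert x (?E - F) \<subseteq> ?E" "?E - insert x (?E - F) = F - {x}" using x F' by auto
    then have "rk (dual M) (insert x (?E - F)) + rank M = card (insert x (?E - F)) + rk M (F - {x})"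
      using rk_dual[OF M, of "insert x (?E - F)"] by simp
    then show ?thesis using rk0 F'(5)[OF x] fin x by simp
  qed
  moreover have "rk (dual M) (?E - F - {x}) = rk (dual M) (?E - F)" if x: "x \<in> ?E - F" for x
  proof -
    have "?E - F - {x} \<subseteq> ?E" "?E - (?E - F - {x}) = insert x F" using x F' by auto
    then have "rk (dual M) (?E - F - {x}) + rank M = card (?E - F - {x}) + rk M (insert x F)"
      using rk_dual[OF M, of "?E - F - {x}"] by simp
    moreover have "rk M (insert x F) = rk M F + 1"
      using F'(4)[OF x] rk_insert_le[OF M, of x F] by simp
    moreover have "card (?E - F) = card (?E - F - {x}) + 1"
      using fin x by (metis Suc_eq_plus1 card_Suc_Diff1)
    ultimately show ?thesis using rk0 by simp
  qed
  ultimately show ?thesis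
    using F'(1-3) by (auto simp: nonempty_proper_cyclic_flats_iff[OF matroid_dual[OF M]])
qed

section \<open>The total nullity of the cyclic flats\<close>

text \<open>The ground set is left out because a free extension raises its nullity, whereas free
  extensions and coextensions preserve the nullities of the remaining cyclic flats.\<close>

definition total_nullity :: "'a mat \<Rightarrow> nat" where
  "total_nullity M = (\<Sum>F\<in>nonempty_proper_cyclic_flats M. card F - rk M F)"

lemma cyclic_flat_nullity_pos:
  assumes M: "matroid M" and F: "F \<in> nonempty_proper_cyclic_flats M"
  shows "rk M F < card F"
proof -
  have F': "F \<noteq> {}" "F \<subseteq> ground M" "\<And>x. x \<in> F \<Longrightarrow> rk M (F - {x}) = rk M F"
    using F by (auto simp: nonempty_proper_cyclic_flats_iff[OF M])
  then obtain x where x: "x \<in> F" by blast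
  have fin: "finite F" using F' matroid_finite[OF M] finite_subset by blast
  have "rk M F \<le> card (F - {x})" using rk_le_card[OF M, of "F - {x}"] F'(3)[OF x] fin by simp
  then show ?thesis using fin x by (metis card_Diff1_less le_less_trans)
qed

text \<open>\<open>F\<close> is the closure of \<open>G\<close> in \<open>M\<close>. That
  \<open>G\<close> is recovered as \<open>F - Y\<close> makes different \<open>G\<close> come from
  different \<open>F\<close>, as the comparison of sums requires.\<close>

lemma nonempty_proper_cyclic_flat_of_delete:
  assumes M: "matroid M" and G: "G \<in> nonempty_proper_cyclic_flats (delete M Y)"
  obtains F where "F \<in> nonempty_proper_cyclic_flats M" "F - Y = G" "rk M F = rk (delete M Y) G"
proof -
  have G': "G \<noteq> {}" "G \<noteq> ground M - Y" "G \<subseteq> ground M - Y"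
    "\<And>x. x \<in> ground M - Y - G \<Longrightarrow> rk (delete M Y) G < rk (delete M Y) (insert x G)"
    "\<And>x. x \<in> G \<Longrightarrow> rk (delete M Y) (G - {x}) = rk (delete M Y) G"
    using G by (auto simp: nonempty_proper_cyclic_flats_iff[OF matroid_delete[OF M]])
  have rkG: "rk (delete M Y) G = rk M G" using G' by (intro rk_delete) blast
  have cyc: "rk M (G - {x}) = rk M G" if "x \<in> G" for x
    using G'(5)[OF that] rkG rk_delete[of "G - {x}" Y M] G'(3) by (simp add: disjoint_iff subset_iff)
  obtain F where F: "F \<in> cyclic_flats M" "G \<subseteq> F" "rk M F = rk M G"
    using cyclic_flat_hull[OF M _ cyc] G'(3) by blast
  have FE: "F \<subseteq> ground M" using F(1) by (auto simp: cyclic_flats_iff[OF M])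
  have "x \<in> G" if x: "x \<in> F - Y" for x
  proof (rule ccontr)
    assume "x \<notin> G"
    then have "rk M G < rk (delete M Y) (insert x G)" using G'(4)[of x] x FE rkG by auto
    also have "\<dots> = rk M (insert x G)" using x G'(3) by (intro rk_delete) blast
    also have "\<dots> \<le> rk M F" using x F by (intro rk_mono[OF M]) blast
    finally show False using F by simp
  qed
  then have FY: "F - Y = G" using F(2) G'(3) by blast
  moreover have "F \<in> nonempty_proper_cyclic_flats M"
    using F FY G' unfolding nonempty_proper_cyclic_flats_def by blast
  ultimately show thesis using that F rkG by simp
qed

lemma total_nullity_delete_less:
  assumes M: "matroid M" and e: "e \<in> Y" "e \<in> F0" "F0 \<in> nonempty_proper_cyclic_flats M"
  shows "total_nullity (delete M Y) < total_nullity M"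
proof -
  let ?Z = "nonempty_proper_cyclic_flats"
  \<comment> \<open>The nullity of \<open>F\<close> with the loss of \<open>e\<close> deducted: the
    trace \<open>F - Y\<close> lacks \<open>e\<close> but has the rank of \<open>F\<close>, so its
    nullity is at most \<open>h F\<close>.\<close>
  define h where "h F = card F - rk M F - (if e \<in> F then 1 else 0)" for F
  have fin: "finite (?Z M)" "finite (?Z (delete M Y))"
    using finite_nonempty_proper_cyclic_flats M matroid_delete by blast+
  have "total_nullity (delete M Y) \<le> (\<Sum>F\<in>?Z M. h F)"
    unfolding total_nullity_def
  proof (rule sum_le_included[where i = "\<lambda>F. F - Y"])
    show "\<forall>G\<in>?Z (delete M Y). \<exists>F\<in>?Z M. F - Y = G \<and> card G - rk (delete M Y) G \<le> h F"
    proof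
      fix G assume "G \<in> ?Z (delete M Y)"
      then obtain F where F: "F \<in> ?Z M" "F - Y = G" "rk M F = rk (delete M Y) G"
        using nonempty_proper_cyclic_flat_of_delete[OF M] by blast
      have finF: "finite F"
        using F(1) matroid_finite[OF M] finite_subset by (auto simp: nonempty_proper_cyclic_flats_iff[OF M])
      have "card G \<le> card F - (if e \<in> F then 1 else 0)"
      proof (cases "e \<in> F")
        case True
        then have "card G \<le> card (F - {e})" using F e finF by (intro card_mono) auto
        then show ?thesis using True finF by simp
      next
        case False
        then show ?thesis using F finF by (auto intro: card_mono)
      qed
      then have "card G - rk (delete M Y) G \<le> h F" using F(3) unfolding h_def by auto
      then show "\<exists>F\<in>?Z M. F - Y = G \<and> card G - rk (delete M Y) G \<le> h F" using F by blast
    qed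
  qed (use fin in auto)
  also have "\<dots> < (\<Sum>F\<in>?Z M. card F - rk M F)"
  proof (rule sum_strict_mono_ex1)
    \<comment> \<open>\<open>F0\<close> has positive nullity, so truncation does not hide the
      deduction.\<close>
    show "\<exists>F\<in>?Z M. h F < card F - rk M F"
      using e cyclic_flat_nullity_pos[OF M e(3)] unfolding h_def by (intro bexI[of _ F0]) auto
  qed (use fin in \<open>auto simp: h_def\<close>)
  finally show ?thesis unfolding total_nullity_def .
qed

lemma nullity_mono:
  assumes M: "matroid M" and "X \<subseteq> Y" "finite Y"
  shows "card X + rk M Y \<le> card Y + rk M X"
proof -
  have "rk M (X \<union> (Y - X)) \<le> rk M X + card (Y - X)" using assms by (intro rk_Un_le_card[OF M]) auto
  moreover have "X \<union> (Y - X) = Y" using assms by auto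
  moreover have "card Y = card X + card (Y - X)"
    using assms by (metis card_Diff_subset card_mono finite_subset le_add_diff_inverse)
  ultimately show ?thesis by simp
qed

text \<open>The nullity of \<open>G\<close> in the contraction is that of
  \<open>G \<union> X\<close> minus that of \<open>X\<close>. The set \<open>F\<close> keeps the
  full nullity of \<open>G \<union> X\<close>, so an element of \<open>G \<union> X\<close> put back
  into \<open>F\<close> must raise the rank. Conversely no element of \<open>F\<close> is an
  isthmus: for elements of \<open>X\<close> by minimality, for those of \<open>G\<close> because
  \<open>G\<close> is cyclic in the contraction.\<close>

lemma nonempty_proper_cyclic_flat_of_contract:
  assumes M: "matroid M" and X: "X \<subseteq> ground M"
    and G: "G \<in> nonempty_proper_cyclic_flats (contract M X)"
  obtains F where "F \<in> nonempty_proper_cyclic_flats M" "F - X = G"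
    "card G - rk (contract M X) G \<le> card F - rk M F"
proof -
  let ?E = "ground M" and ?c = "contract M X"
  have G': "G \<noteq> {}" "G \<noteq> ?E - X" "G \<subseteq> ?E - X"
    "\<And>x. x \<in> ?E - X - G \<Longrightarrow> rk ?c G < rk ?c (insert x G)"
    "\<And>x. x \<in> G \<Longrightarrow> rk ?c (G - {x}) = rk ?c G"
    using G by (auto simp: nonempty_proper_cyclic_flats_iff[OF matroid_contract[OF M]])
  have rkc: "rk ?c Z + rk M X = rk M (Z \<union> X)" if "Z \<subseteq> ?E - X" for Z
    using rk_contract[OF M X that] .
  have finGX: "finite (G \<union> X)" using G' X matroid_finite[OF M] by (meson Diff_subset finite_UnI finite_subset)
  let ?P = "\<lambda>F. G \<subseteq> F \<and> F \<subseteq> G \<union> X \<and> card (G \<union> X) + rk M F \<le> card F + rk M (G \<union> X)"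
  txt \<open>A smallest subset of \<open>G \<union> X\<close> of full nullity: it is \<open>G \<union> X\<close> without the isthmuses.\<close>
  obtain F where F: "G \<subseteq> F" "F \<subseteq> G \<union> X" "card (G \<union> X) + rk M F \<le> card F + rk M (G \<union> X)"
    and min: "\<And>F'. ?P F' \<Longrightarrow> card F \<le> card F'"
    using ex_has_least_nat[of ?P "G \<union> X" card] by blast
  have finF: "finite F" using F finGX finite_subset by blast
  have FE: "F \<subseteq> ?E" using F G' X by blast
  have FX: "F - X = G" using F G'(3) by blast
  have flat_GX: "rk M (G \<union> X) < rk M (insert x (G \<union> X))" if x: "x \<in> ?E - (G \<union> X)" for x
  proof -
    have "rk ?c G < rk ?c (insert x G)" using G'(4) x by blast
    then show ?thesis using rkc[of G] rkc[of "insert x G"] G'(3) x by auto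
  qed
  have "rk M F < rk M (insert x F)" if x: "x \<in> ?E - F" for x
  proof (cases "x \<in> G \<union> X")
    case True
    have "card (insert x F) + rk M (G \<union> X) \<le> card (G \<union> X) + rk M (insert x F)"
      using F True finGX by (intro nullity_mono[OF M]) auto
    then show ?thesis using F(3) finF x by simp
  next
    case False
    then show ?thesis using rk_less_insert_subset[OF M F(2), of x] flat_GX x by blast
  qed
  moreover have "rk M (F - {x}) = rk M F" if x: "x \<in> F" for x
  proof (rule ccontr)
    assume neq: "rk M (F - {x}) \<noteq> rk M F"
    have cF: "card F = card (F - {x}) + 1" using finF x by (metis Suc_eq_plus1 card_Suc_Diff1)
    have "rk M (F - {x}) \<le> rk M F" by (rule rk_mono[OF M]) blast
    then have less: "rk M (F - {x}) + 1 \<le> rk M F" using neq by simp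
    show False
    proof (cases "x \<in> G")
      case True
      have "rk ?c (G - {x}) = rk ?c G" using G'(5)[OF True] .
      moreover have "G - {x} \<union> X = G \<union> X - {x}" using True G'(3) by blast
      ultimately have "rk M (G \<union> X - {x}) = rk M (G \<union> X)"
        using rkc[of G] rkc[of "G - {x}"] G'(3) by (metis Diff_subset order_trans)
      moreover have "card (F - {x}) + rk M (G \<union> X - {x}) \<le> card (G \<union> X - {x}) + rk M (F - {x})"
        using F finGX by (intro nullity_mono[OF M]) auto
      moreover have "card (G \<union> X) = card (G \<union> X - {x}) + 1"
        using finGX True by (metis Suc_eq_plus1 UnI1 card_Suc_Diff1)
      ultimately show False using F(3) cF less by linarith
    next
      case False
      then have "?P (F - {x})" using F cF less by auto
      then show False using min[of "F - {x}"] cF by simp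
    qed
  qed
  moreover have "F \<noteq> {}" "F \<noteq> ?E" using FX G' by auto
  ultimately have "F \<in> nonempty_proper_cyclic_flats M"
    using FE by (auto simp: nonempty_proper_cyclic_flats_iff[OF M])
  moreover have "card G - rk ?c G \<le> card F - rk M F"
  proof -
    have "card (G \<union> X) = card G + card X"
      using finGX G'(3) by (intro card_Un_disjoint) auto
    moreover have "rk M X \<le> card X" using finGX by (intro rk_le_card[OF M]) simp
    ultimately show ?thesis using rkc[OF G'(3)] F(3) by linarith
  qed
  ultimately show thesis using that FX by blast
qed

lemma total_nullity_contract_le:
  assumes M: "matroid M" and X: "X \<subseteq> ground M"
  shows "total_nullity (contract M X) \<le> total_nullity M"
  unfolding total_nullity_def
proof (rule sum_le_included[where i = "\<lambda>F. F - X"])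
  show "\<forall>G\<in>nonempty_proper_cyclic_flats (contract M X). \<exists>F\<in>nonempty_proper_cyclic_flats M.
      F - X = G \<and> card G - rk (contract M X) G \<le> card F - rk M F"
    using nonempty_proper_cyclic_flat_of_contract[OF M X] by metis
qed (use finite_nonempty_proper_cyclic_flats M matroid_contract in auto)

text \<open>By commutation the deletion can be carried out first, where \<open>F\<close> is still a
  cyclic flat; the contraction afterwards cannot restore the loss.\<close>

lemma total_nullity_minor_less:
  assumes M: "matroid M" and "X \<subseteq> ground M" "X \<inter> Y = {}"
    and "e \<in> Y" "e \<in> F" "F \<in> nonempty_proper_cyclic_flats M"
  shows "total_nullity (delete (contract M X) Y) < total_nullity M"
proof -
  have "total_nullity (delete (contract M X) Y) = total_nullity (contract (delete M Y) X)"
    using delete_contract_commute[OF assms(1-3)] by simp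
  also have "\<dots> \<le> total_nullity (delete M Y)"
    by (rule total_nullity_contract_le[OF matroid_delete[OF M]]) (use assms in auto)
  also have "\<dots> < total_nullity M" using total_nullity_delete_less[OF M assms(4-6)] .
  finally show ?thesis .
qed

section \<open>Isomorphisms\<close>

lemma rk_iso:
  assumes M: "matroid M" and N: "matroid N" and f: "bij_betw f (ground M) (ground N)"
    and ind: "\<And>X. X \<subseteq> ground M \<Longrightarrow> X \<in> indeps M \<longleftrightarrow> f ` X \<in> indeps N"
    and X: "X \<subseteq> ground M"
  shows "rk N (f ` X) = rk M X"
proof (rule antisym)
  have inj: "inj_on f (ground M)" using f by (rule bij_betw_imp_inj_on)
  have card: "card (f ` I) = card I" if "I \<subseteq> X" for I
    using that X inj by (intro card_image) (meson inj_on_subset order_trans)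
  obtain J where J: "J \<in> indeps N" "J \<subseteq> f ` X" "card J = rk N (f ` X)"
    by (rule extend_to_rk[OF N empty_indep[OF N], of "f ` X"]) simp_all
  then obtain I where I: "I \<subseteq> X" "J = f ` I" by (auto simp: subset_image_iff)
  then have "I \<in> indeps M" using ind[of I] J X by blast
  then show "rk N (f ` X) \<le> rk M X" using card_le_rk[OF M _ I(1)] J I card by metis
  obtain I where I: "I \<in> indeps M" "I \<subseteq> X" "card I = rk M X"
    by (rule extend_to_rk[OF M empty_indep[OF M], of X]) simp_all
  then have "f ` I \<in> indeps N" using ind[of I] X by blast
  then show "rk M X \<le> rk N (f ` X)" using card_le_rk[OF N, of "f ` I" "f ` X"] I card by auto
qed

lemma isomorphicE:
  assumes "isomorphic M N" "matroid M" "matroid N"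
  obtains f where "bij_betw f (ground M) (ground N)" "\<And>X. X \<subseteq> ground M \<Longrightarrow> rk N (f ` X) = rk M X"
  using assms rk_iso unfolding isomorphic_def by metis

lemma isomorphicI:
  assumes M: "matroid M" and N: "matroid N" and f: "bij_betw f (ground M) (ground N)"
    and rk: "\<And>X. X \<subseteq> ground M \<Longrightarrow> rk N (f ` X) = rk M X"
  shows "isomorphic M N"
proof -
  have "X \<in> indeps M \<longleftrightarrow> f ` X \<in> indeps N" if X: "X \<subseteq> ground M" for X
  proof -
    have "f ` X \<subseteq> ground N" using f X bij_betw_imp_surj_on by blast
    moreover have "card (f ` X) = card X"
      using X f by (meson bij_betw_imp_inj_on card_image inj_on_subset)
    ultimately show ?thesis using rk[OF X] X by (simp add: indep_iff_rk[OF M] indep_iff_rk[OF N])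
  qed
  then show ?thesis unfolding isomorphic_def using f by blast
qed

lemma isomorphic_refl: "isomorphic M M"
  unfolding isomorphic_def by (intro exI[of _ id]) simp

lemma isomorphic_ranks:
  assumes "isomorphic M N" "matroid M" "matroid N"
  shows "rank M = rank N"
  using isomorphicE[OF assms] by (metis bij_betw_imp_surj_on subset_refl)

lemma isomorphic_dual:
  assumes iso: "isomorphic M N" and M: "matroid M" and N: "matroid N"
  shows "isomorphic (dual M) (dual N)"
proof -
  obtain f where f: "bij_betw f (ground M) (ground N)"
    and rk: "\<And>X. X \<subseteq> ground M \<Longrightarrow> rk N (f ` X) = rk M X"
    using isomorphicE[OF assms] by blast
  have surj: "f ` ground M = ground N" and inj: "inj_on f (ground M)"
    using f by (auto simp: bij_betw_def)
  have "rk (dual N) (f ` X) = rk (dual M) X" if X: "X \<subseteq> ground M" for X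
  proof -
    have "f ` (ground M - X) = ground N - f ` X"
      using inj_on_image_set_diff[OF inj, of "ground M" X] X surj by auto
    then have "rk N (ground N - f ` X) = rk M (ground M - X)" using rk[of "ground M - X"] by simp
    moreover have "card (f ` X) = card X" using X inj by (meson card_image inj_on_subset)
    moreover have "rank N = rank M" using rk[of "ground M"] surj by simp
    moreover have "f ` X \<subseteq> ground N" using X surj by blast
    ultimately show ?thesis using rk_dual[OF M X] rk_dual[OF N, of "f ` X"] by simp
  qed
  then show ?thesis using f by (intro isomorphicI[of _ _ f] matroid_dual M N) auto
qed

lemma total_nullity_isomorphic:
  assumes iso: "isomorphic M N" and M: "matroid M" and N: "matroid N"
  shows "total_nullity N \<le> total_nullity M"
proof -
  obtain f where f: "bij_betw f (ground M) (ground N)"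
    and rk: "\<And>X. X \<subseteq> ground M \<Longrightarrow> rk N (f ` X) = rk M X"
    using isomorphicE[OF assms] by blast
  have surj: "f ` ground M = ground N" and inj: "inj_on f (ground M)"
    using f by (auto simp: bij_betw_def)
  have "\<exists>F\<in>nonempty_proper_cyclic_flats M. f ` F = G \<and> card G - rk N G \<le> card F - rk M F"
    if G: "G \<in> nonempty_proper_cyclic_flats N" for G
  proof -
    have G': "G \<noteq> {}" "G \<noteq> ground N" "G \<subseteq> ground N"
      "\<And>x. x \<in> ground N - G \<Longrightarrow> rk N G < rk N (insert x G)" "\<And>x. x \<in> G \<Longrightarrow> rk N (G - {x}) = rk N G"
      using G by (auto simp: nonempty_proper_cyclic_flats_iff[OF N])
    obtain F where F: "F \<subseteq> ground M" "G = f ` F" using G'(3) surj by (metis subset_image_iff)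
    have "rk M F < rk M (insert x F)" if x: "x \<in> ground M - F" for x
    proof -
      have "f x \<in> ground N - G" using x F surj inj by (auto simp: inj_on_image_mem_iff)
      then show ?thesis using G'(4)[of "f x"] rk[of F] rk[of "insert x F"] F x by simp
    qed
    moreover have "rk M (F - {x}) = rk M F" if x: "x \<in> F" for x
    proof -
      have "f ` (F - {x}) = G - {f x}"
        using inj_on_image_set_diff[OF inj, of F "{x}"] F x by auto
      moreover have "F - {x} \<subseteq> ground M" using F by blast
      ultimately show ?thesis using G'(5)[of "f x"] rk[of F] rk[of "F - {x}"] F x by simp
    qed
    moreover have "F \<noteq> {}" "F \<noteq> ground M" using G' F surj by auto
    ultimately have "F \<in> nonempty_proper_cyclic_flats M"
      using F by (auto simp: nonempty_proper_cyclic_flats_iff[OF M])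
    moreover have "card G = card F" using F inj by (metis card_image inj_on_subset)
    ultimately show ?thesis using rk[OF F(1)] F(2) by auto
  qed
  then show ?thesis
    unfolding total_nullity_def
    by (intro sum_le_included[where i = "\<lambda>F. f ` F"])
      (auto simp: finite_nonempty_proper_cyclic_flats M N)
qed

section \<open>Free extensions and coextensions by sets\<close>

text \<open>\<open>expand N D C\<close> arises from \<open>N\<close> by freely coextending by the elements of \<open>D\<close> and freely
  extending by the elements of \<open>C\<close>.\<close>

definition expand_bound :: "'a mat \<Rightarrow> 'a set \<Rightarrow> 'a set \<Rightarrow> 'a set \<Rightarrow> nat" where
  "expand_bound N D C X = rk N (X \<inter> ground N) + card D + card (X \<inter> C)"

text \<open>The third bound is an upper bound for the rank of \<open>X \<union> D\<close>:
  contracting \<open>D\<close> gives back \<open>N\<close> on its ground set, and each element of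
  \<open>C\<close> adds at most one. Freeness means that nothing besides size, total rank and this
  bound limits the rank.\<close>

definition expand_rk :: "'a mat \<Rightarrow> 'a set \<Rightarrow> 'a set \<Rightarrow> 'a set \<Rightarrow> nat" where
  "expand_rk N D C X = min (card X) (min (rank N + card D) (expand_bound N D C X))"

definition expand :: "'a mat \<Rightarrow> 'a set \<Rightarrow> 'a set \<Rightarrow> 'a mat" where
  "expand N D C = mat_of_rank (ground N \<union> D \<union> C) (expand_rk N D C)"

lemma ground_expand [simp]: "ground (expand N D C) = ground N \<union> D \<union> C"
  by (simp add: expand_def)

text \<open>The free extension is \<open>M\<close> with \<open>x\<close> added as an isthmus,
  truncated to the rank of \<open>M\<close>.\<close>

lemma indeps_free_extension:
  assumes M: "matroid M" and x: "x \<notin> ground M"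
  shows "I \<in> indeps (free_extension M x) \<longleftrightarrow>
    I \<subseteq> insert x (ground M) \<and> I - {x} \<in> indeps M \<and> card I \<le> rank M"
proof (cases "I \<subseteq> insert x (ground M)")
  case True
  have fin: "finite I" using True matroid_finite[OF M] by (meson finite_insert finite_subset)
  have "(\<forall>C\<in>circuits M. \<not> C \<subseteq> I) \<longleftrightarrow> I - {x} \<in> indeps M"
  proof
    assume none: "\<forall>C\<in>circuits M. \<not> C \<subseteq> I"
    show "I - {x} \<in> indeps M"
    proof (rule ccontr)
      assume "I - {x} \<notin> indeps M"
      then obtain C where "C \<in> circuits M" "C \<subseteq> I - {x}"
        using dependent_contains_circuit[OF M, of "I - {x}"] True by blast
      then show False using none by blast
    qed
  next
    assume ind: "I - {x} \<in> indeps M"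
    show "\<forall>C\<in>circuits M. \<not> C \<subseteq> I"
    proof (intro ballI notI)
      fix C assume C: "C \<in> circuits M" "C \<subseteq> I"
      then have "C \<subseteq> I - {x}" using x unfolding circuits_def by blast
      then have "C \<in> indeps M" using indep_subset[OF M ind] by blast
      then show False using C unfolding circuits_def by blast
    qed
  qed
  moreover have "(\<forall>B\<in>bases M. \<not> insert x B \<subseteq> I) \<longleftrightarrow> card I \<le> rank M" if ind: "I - {x} \<in> indeps M"
  proof (cases "x \<in> I")
    case x_in: True
    have cI: "card I = card (I - {x}) + 1" using fin x_in by (metis Suc_eq_plus1 card_Suc_Diff1)
    have le: "card (I - {x}) \<le> rank M" using card_le_rk[OF M ind] indep_subset_ground[OF M ind] by blast
    show ?thesis
    proof
      assume none: "\<forall>B\<in>bases M. \<not> insert x B \<subseteq> I"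
      have "card (I - {x}) \<noteq> rank M"
      proof
        assume "card (I - {x}) = rank M"
        then have "I - {x} \<in> bases M" using ind by (simp add: basis_iff[OF M])
        then show False using none x_in by blast
      qed
      then show "card I \<le> rank M" using le cI by simp
    next
      assume cle: "card I \<le> rank M"
      show "\<forall>B\<in>bases M. \<not> insert x B \<subseteq> I"
      proof (intro ballI notI)
        fix B assume B: "B \<in> bases M" "insert x B \<subseteq> I"
        then have "B \<in> indeps M" "card B = rank M" by (auto simp: basis_iff[OF M])
        moreover then have "B \<subseteq> I - {x}" using B x indep_subset_ground[OF M] by blast
        then have "card B \<le> card (I - {x})" using fin by (intro card_mono) auto
        ultimately show False using cle cI by simp
      qed
    qed
  next
    case False
    then have "I \<in> indeps M" using ind by simp
    then show ?thesis using False card_le_rk[OF M, of I] indep_subset_ground[OF M, of I] by auto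
  qed
  moreover have "I \<in> indeps (free_extension M x) \<longleftrightarrow>
      (\<forall>C\<in>circuits M. \<not> C \<subseteq> I) \<and> (\<forall>B\<in>bases M. \<not> insert x B \<subseteq> I)"
    by (simp add: free_extension_def of_circuits_def ball_Un True)
  ultimately show ?thesis using True by blast
qed (auto simp: free_extension_def of_circuits_def)

locale expansion =
  fixes N :: "'a mat" and D C :: "'a set"
  assumes N: "matroid N" and finite_D: "finite D" and finite_C: "finite C"
    and disj: "D \<inter> ground N = {}" "C \<inter> ground N = {}" "D \<inter> C = {}"
begin

abbreviation E where "E \<equiv> ground N \<union> D \<union> C"

lemma finite_E: "finite E"
  using matroid_finite[OF N] finite_D finite_C by blast

lemma card_split:
  assumes "X \<subseteq> E"
  shows "card X = card (X \<inter> ground N) + card (X \<inter> D) + card (X \<inter> C)"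
proof -
  have "finite X" using assms finite_E finite_subset by blast
  moreover have "X = (X \<inter> ground N \<union> X \<inter> D) \<union> X \<inter> C" using assms by blast
  ultimately show ?thesis
    using disj card_Un_disjoint[of "X \<inter> ground N \<union> X \<inter> D" "X \<inter> C"]
      card_Un_disjoint[of "X \<inter> ground N" "X \<inter> D"] by fastforce
qed

lemma expand_rk_le:
  "expand_rk N D C X \<le> card X" "expand_rk N D C X \<le> rank N + card D"
  "expand_rk N D C X \<le> expand_bound N D C X"
  unfolding expand_rk_def by auto

lemma expand_rk_cases:
  obtains "expand_rk N D C X = card X" | "expand_rk N D C X = rank N + card D"
  | "expand_rk N D C X = expand_bound N D C X"
  unfolding expand_rk_def min_def by presburger

lemma expand_bound_mono:
  assumes "X \<subseteq> Y"
  shows "expand_bound N D C X \<le> expand_bound N D C Y"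
proof -
  have "rk N (X \<inter> ground N) \<le> rk N (Y \<inter> ground N)" by (rule rk_mono[OF N]) (use assms in blast)
  moreover have "card (X \<inter> C) \<le> card (Y \<inter> C)" using assms finite_C by (intro card_mono) auto
  ultimately show ?thesis unfolding expand_bound_def by simp
qed

lemma expand_bound_submod:
  "expand_bound N D C (X \<union> Y) + expand_bound N D C (X \<inter> Y) \<le> expand_bound N D C X + expand_bound N D C Y"
proof -
  have "rk N ((X \<inter> ground N) \<union> (Y \<inter> ground N)) + rk N ((X \<inter> ground N) \<inter> (Y \<inter> ground N)) \<le>
      rk N (X \<inter> ground N) + rk N (Y \<inter> ground N)" by (rule rk_submod[OF N])
  moreover have "(X \<inter> ground N) \<union> (Y \<inter> ground N) = (X \<union> Y) \<inter> ground N"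
    "(X \<inter> ground N) \<inter> (Y \<inter> ground N) = X \<inter> Y \<inter> ground N" by auto
  moreover have "card (X \<inter> C) + card (Y \<inter> C) = card (X \<inter> C \<union> Y \<inter> C) + card (X \<inter> C \<inter> (Y \<inter> C))"
    using finite_C by (intro card_Un_Int) auto
  moreover have "X \<inter> C \<union> Y \<inter> C = (X \<union> Y) \<inter> C" "X \<inter> C \<inter> (Y \<inter> C) = X \<inter> Y \<inter> C" by auto
  ultimately show ?thesis unfolding expand_bound_def by simp
qed

text \<open>For the mixed case of submodularity, where one rank is a cardinality and the other the
  bound: an element of \<open>X - Y\<close> raises the bound by at most one.\<close>

lemma expand_bound_Un_le:
  assumes "X \<subseteq> E"
  shows "expand_bound N D C (X \<union> Y) + card (X \<inter> Y) \<le> card X + expand_bound N D C Y"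
proof -
  let ?W = "X - Y"
  have fin: "finite X" using assms finite_E finite_subset by blast
  have "rk N (Y \<inter> ground N \<union> ?W \<inter> ground N) \<le> rk N (Y \<inter> ground N) + card (?W \<inter> ground N)"
    using fin by (intro rk_Un_le_card[OF N]) auto
  moreover have "Y \<inter> ground N \<union> ?W \<inter> ground N = (X \<union> Y) \<inter> ground N" by auto
  moreover have "(X \<union> Y) \<inter> C = Y \<inter> C \<union> ?W \<inter> C" by auto
  then have "card ((X \<union> Y) \<inter> C) \<le> card (Y \<inter> C) + card (?W \<inter> C)" by (simp add: card_Un_le)
  moreover have "card (?W \<inter> ground N) + card (?W \<inter> C) \<le> card ?W"
    using card_split[of ?W] assms by (simp add: subset_iff)
  moreover have "card X = card (X \<inter> Y) + card ?W" using card_Int_Diff[OF fin] by blast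
  ultimately show ?thesis unfolding expand_bound_def by simp
qed

lemma rank_function_expand_rk: "rank_function E (expand_rk N D C)"
proof (rule rank_functionI)
  show "finite E" by (rule finite_E)
  show "expand_rk N D C X \<le> card X" for X by (rule expand_rk_le)
  show "expand_rk N D C X \<le> expand_rk N D C Y" if "X \<subseteq> Y" "Y \<subseteq> E" for X Y
  proof -
    have "card X \<le> card Y" using that finite_E by (meson card_mono finite_subset)
    then show ?thesis using expand_bound_mono[OF that(1)] unfolding expand_rk_def by auto
  qed
  show "expand_rk N D C (X \<union> Y) + expand_rk N D C (X \<inter> Y) \<le> expand_rk N D C X + expand_rk N D C Y"
    if XY: "X \<subseteq> E" "Y \<subseteq> E" for X Y
  proof -
    have "finite X" "finite Y" using XY finite_E by (meson finite_subset)+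
    then have "card X + card Y = card (X \<union> Y) + card (X \<inter> Y)" by (rule card_Un_Int)
    moreover note expand_rk_le[of "X \<union> Y"] expand_rk_le[of "X \<inter> Y"] expand_bound_submod[of X Y]
      expand_bound_mono[OF Int_lower1, of X Y] expand_bound_mono[OF Int_lower2, of X Y]
    moreover have "expand_bound N D C (X \<union> Y) + card (X \<inter> Y) \<le> card X + expand_bound N D C Y"
      "expand_bound N D C (X \<union> Y) + card (X \<inter> Y) \<le> card Y + expand_bound N D C X"
      using expand_bound_Un_le[OF XY(1), of Y] expand_bound_Un_le[OF XY(2), of X]
      by (simp_all add: Un_commute Int_commute)
    moreover have "card (X \<inter> Y) \<le> card X" "card (X \<inter> Y) \<le> card Y"
      using \<open>finite X\<close> \<open>finite Y\<close> by (auto intro: card_mono)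
    \<comment> \<open>Nine cases, by the terms attaining the two minima on the right; in each,
      suitable upper bounds for union and intersection are among the facts collected.\<close>
    ultimately show ?thesis
      by (cases rule: expand_rk_cases[of X]; cases rule: expand_rk_cases[of Y]; linarith)
  qed
qed

lemma matroid_expand: "matroid (expand N D C)"
  unfolding expand_def by (rule matroid_mat_of_rank[OF rank_function_expand_rk])

lemma rk_expand: "X \<subseteq> E \<Longrightarrow> rk (expand N D C) X = expand_rk N D C X"
  unfolding expand_def by (rule rk_mat_of_rank[OF rank_function_expand_rk])

lemma indep_expand:
  "X \<in> indeps (expand N D C) \<longleftrightarrow>
    X \<subseteq> E \<and> card X \<le> rank N + card D \<and> card X \<le> expand_bound N D C X"
  unfolding expand_def mat_of_rank_def expand_rk_def by auto

lemma rank_expand: "rank (expand N D C) = rank N + card D"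
proof -
  have E: "E \<inter> ground N = ground N" "E \<inter> C = C" "E \<inter> D = D" by auto
  have "rank N \<le> card (ground N)" by (rule rk_le_card[OF N matroid_finite[OF N]])
  then have "rank N + card D \<le> card E" using card_split[of E] E by simp
  then show ?thesis using rk_expand[of E] E unfolding expand_rk_def expand_bound_def by simp
qed

lemma expansion_dual: "expansion (dual N) C D"
  by unfold_locales (use matroid_dual[OF N] finite_C finite_D disj in auto)

text \<open>Passing to the complement exchanges the size term with the total rank term of the
  minimum, and carries the third term into the third term for the dual, with \<open>C\<close> and
  \<open>D\<close> interchanged.\<close>

lemma dual_expand: "dual (expand N D C) = expand (dual N) C D"
proof (rule matroid_eqI)
  interpret dual: expansion "dual N" C D by (rule expansion_dual)
  show "matroid (expand (dual N) C D)" by (rule dual.matroid_expand)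
  show "ground (dual (expand N D C)) = ground (expand (dual N) C D)" by auto
  fix X assume "X \<subseteq> ground (dual (expand N D C))"
  then have X: "X \<subseteq> E" by simp
  let ?R = "ground N"
  have "rk (dual (expand N D C)) X + (rank N + card D) = card X + expand_rk N D C (E - X)"
    using rk_dual[OF matroid_expand, of X] X rank_expand rk_expand[of "E - X"] by simp
  moreover have "rk (expand (dual N) C D) X = expand_rk (dual N) C D X"
    using dual.rk_expand[of X] X by (simp add: Un_ac)
  moreover have "rank (dual N) + rank N = card ?R"
    using rk_dual[OF N, of ?R] rk_le_card[OF N, of "{}"] by simp
  moreover have "rk (dual N) (X \<inter> ?R) + rank N = card (X \<inter> ?R) + rk N (?R - X)"
    using rk_dual[OF N, of "X \<inter> ?R"] by (simp add: Diff_Int_distrib2 Diff_Int)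
  moreover have "(E - X) \<inter> ?R = ?R - X" "(E - X) \<inter> C = C - X" by auto
  then have "expand_bound N D C (E - X) = rk N (?R - X) + card D + card (C - X)"
    by (simp add: expand_bound_def)
  moreover have "expand_bound (dual N) C D X = rk (dual N) (X \<inter> ?R) + card C + card (X \<inter> D)"
    by (simp add: expand_bound_def)
  moreover have "card C = card (X \<inter> C) + card (C - X)"
    using card_Int_Diff[OF finite_C, of X] by (simp add: Int_commute)
  moreover have "card X + card (E - X) = card ?R + card D + card C"
  proof -
    have "E \<inter> ?R = ?R" "E \<inter> D = D" "E \<inter> C = C" by auto
    then have "card E = card ?R + card D + card C" using card_split[of E] by simp
    moreover have "card E = card (E \<inter> X) + card (E - X)" by (rule card_Int_Diff[OF finite_E])
    moreover have "E \<inter> X = X" using X by blast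
    ultimately show ?thesis by simp
  qed
  moreover note card_split[OF X] expand_rk_le[of "E - X"] dual.expand_rk_le[of X]
  ultimately show "rk (dual (expand N D C)) X = rk (expand (dual N) C D) X"
    by (cases rule: expand_rk_cases[of "E - X"]; cases rule: dual.expand_rk_cases[of X]; linarith)
qed (rule matroid_dual[OF matroid_expand])

text \<open>Removing \<open>x\<close> from \<open>I\<close> changes size and bound by the same
  amount, so their comparison is unaffected; only the limit by the total rank is new, as in a
  truncation.\<close>

lemma free_extension_expand:
  assumes x: "x \<notin> E"
  shows "free_extension (expand N D C) x = expand N D (insert x C)"
proof (rule mat.equality)
  interpret ext: expansion N D "insert x C"
    by unfold_locales (use N finite_D finite_C disj x in auto)
  show "ground (free_extension (expand N D C) x) = ground (expand N D (insert x C))"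
    by (auto simp: free_extension_def of_circuits_def)
  have "I \<in> indeps (free_extension (expand N D C) x) \<longleftrightarrow> I \<in> indeps (expand N D (insert x C))" for I
  proof (cases "I \<subseteq> insert x E")
    case True
    have fin: "finite I" using True finite_E by (meson finite_insert finite_subset)
    have "(I - {x}) \<inter> ground N = I \<inter> ground N" using x by blast
    moreover have "I - {x} \<subseteq> E" using True by blast
    moreover have "card (I \<inter> insert x C) = card ((I - {x}) \<inter> C) + (if x \<in> I then 1 else 0)"
      using x finite_C by (auto simp: Int_insert_right Diff_Int_distrib2)
    moreover have "card I = card (I - {x}) + (if x \<in> I then 1 else 0)"
      using card.remove[OF fin, of x] by simp
    ultimately have bounds: "expand_bound N D (insert x C) I = expand_bound N D C (I - {x}) + (if x \<in> I then 1 else 0)"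
      "card I = card (I - {x}) + (if x \<in> I then 1 else 0)" "I - {x} \<subseteq> E"
      unfolding expand_bound_def by simp_all
    have "I \<in> indeps (free_extension (expand N D C) x) \<longleftrightarrow>
        card (I - {x}) \<le> rank N + card D \<and> card (I - {x}) \<le> expand_bound N D C (I - {x}) \<and>
        card I \<le> rank N + card D"
    proof -
      have "x \<notin> ground (expand N D C)" using x by simp
      then show ?thesis
        unfolding indeps_free_extension[OF matroid_expand \<open>x \<notin> ground (expand N D C)\<close>] indep_expand rank_expand
        unfolding ground_expand using True bounds(3) by blast
    qed
    moreover have "I \<in> indeps (expand N D (insert x C)) \<longleftrightarrow>
        card I \<le> rank N + card D \<and> card I \<le> expand_bound N D (insert x C) I"
      using ext.indep_expand[of I] True by simp
    moreover have "card (I - {x}) \<le> expand_bound N D C (I - {x}) \<longleftrightarrow>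
        card I \<le> expand_bound N D (insert x C) I"
      by (simp only: bounds(1,2) add_le_cancel_right)
    moreover have "card (I - {x}) \<le> card I" using bounds(2) by linarith
    ultimately show ?thesis by (meson le_trans)
  qed (use x in \<open>auto simp: indeps_free_extension[OF matroid_expand] ext.indep_expand\<close>)
  then show "indeps (free_extension (expand N D C) x) = indeps (expand N D (insert x C))" by blast
qed simp

lemma free_coextension_expand:
  assumes x: "x \<notin> E"
  shows "free_coextension (expand N D C) x = expand N (insert x D) C"
proof -
  interpret dual: expansion "dual N" C D by (rule expansion_dual)
  interpret coext: expansion N "insert x D" C
    by unfold_locales (use N finite_D finite_C disj x in auto)
  have "free_coextension (expand N D C) x = dual (expand (dual N) C (insert x D))"
    using dual.free_extension_expand[of x] x by (simp add: free_coextension_def dual_expand)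
  also have "\<dots> = expand N (insert x D) C"
    using coext.dual_expand dual_dual[OF coext.matroid_expand] by simp
  finally show ?thesis .
qed

end

lemma expand_empty:
  assumes N: "matroid N"
  shows "expand N {} {} = N"
proof -
  interpret expansion N "{}" "{}" by unfold_locales (use N in auto)
  have "expand_rk N {} {} X = rk N X" if X: "X \<subseteq> ground N" for X
  proof -
    have "rk N X \<le> card X" using X matroid_finite[OF N] by (intro rk_le_card[OF N]) (meson finite_subset)
    moreover have "rk N X \<le> rank N" by (rule rk_mono[OF N X])
    moreover have "X \<inter> ground N = X" using X by blast
    ultimately show ?thesis unfolding expand_rk_def expand_bound_def by simp
  qed
  then show ?thesis
    using rk_expand by (intro matroid_eqI) (auto simp: N matroid_expand)
qed

lemma (in expansion) obtainable_expand: "obtainable N (expand N D C)"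
proof -
  have "obtainable N (expand N D {})"
    using finite_D disj(1)
  proof (induction D)
    case empty
    then show ?case using expand_empty[OF N] obtainable.start by metis
  next
    case (insert x D)
    interpret e: expansion N D "{}" by unfold_locales (use N insert in auto)
    show ?case
      using e.free_coextension_expand[of x] obtainable.coextend[OF insert.IH, of x] insert.hyps insert.prems
      by auto
  qed
  with finite_C show ?thesis
    using disj(2,3)
  proof (induction C)
    case (insert x C)
    interpret e: expansion N D C by unfold_locales (use N insert finite_D disj in auto)
    show ?case
      using e.free_extension_expand[of x] obtainable.extend[OF insert.IH, of x] insert disj
      by auto
  qed
qed

section \<open>Cyclic flats of an expansion and the elements removable from it\<close>

context expansion
begin

text \<open>At \<open>F \<union> D\<close> the third term is strictly smallest: below the size as
  \<open>F\<close> has positive nullity, below the total rank as \<open>F\<close> is a proper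
  flat.\<close>

lemma expand_rk_cyclic_flat:
  assumes F: "F \<in> nonempty_proper_cyclic_flats N"
  shows "expand_bound N D C (F \<union> D) = rk N F + card D" "rk N F + card D < card (F \<union> D)"
    "rk N F + card D < rank N + card D"
proof -
  have F': "F \<noteq> {}" "F \<noteq> ground N" "F \<subseteq> ground N"
    "\<And>x. x \<in> ground N - F \<Longrightarrow> rk N F < rk N (insert x F)"
    using F by (auto simp: nonempty_proper_cyclic_flats_iff[OF N])
  have "(F \<union> D) \<inter> ground N = F" "(F \<union> D) \<inter> C = {}" using F' disj by auto
  then show "expand_bound N D C (F \<union> D) = rk N F + card D" unfolding expand_bound_def by simp
  have "card (F \<union> D) = card F + card D"
    using F' disj finite_D matroid_finite[OF N] by (intro card_Un_disjoint) (auto intro: finite_subset)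
  then show "rk N F + card D < card (F \<union> D)" using cyclic_flat_nullity_pos[OF N F] by simp
  obtain x where x: "x \<in> ground N - F" using F' by blast
  then have "insert x F \<subseteq> ground N" using F' by blast
  then have "rk N F < rank N" using F'(4)[OF x] rk_mono[OF N, of "insert x F" "ground N"] by simp
  then show "rk N F + card D < rank N + card D" by simp
qed

lemma rk_expand_cyclic_flat:
  assumes F: "F \<in> nonempty_proper_cyclic_flats N"
  shows "rk (expand N D C) (F \<union> D) = rk N F + card D"
proof -
  have "F \<union> D \<subseteq> E" using F by (auto simp: nonempty_proper_cyclic_flats_iff[OF N])
  then show ?thesis using rk_expand[of "F \<union> D"] expand_rk_cyclic_flat[OF F] unfolding expand_rk_def by simp
qed

text \<open>A nonempty proper cyclic flat \<open>W\<close> is dependent and not spanning, so the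
  third term gives its rank. Elements of \<open>D\<close> do not affect that term, so flatness puts
  all of \<open>D\<close> into \<open>W\<close>; elements of \<open>C\<close> always raise it, so
  cyclicity keeps them out. What remains is the condition on \<open>N\<close>.\<close>

lemma nonempty_proper_cyclic_flats_expand:
  "nonempty_proper_cyclic_flats (expand N D C) = {F \<union> D | F. F \<in> nonempty_proper_cyclic_flats N}"
proof (intro equalityI subsetI)
  fix W assume "W \<in> {F \<union> D | F. F \<in> nonempty_proper_cyclic_flats N}"
  then obtain F where W: "W = F \<union> D" and F: "F \<in> nonempty_proper_cyclic_flats N" by blast
  have F': "F \<noteq> {}" "F \<noteq> ground N" "F \<subseteq> ground N"
    "\<And>x. x \<in> ground N - F \<Longrightarrow> rk N F < rk N (insert x F)" "\<And>x. x \<in> F \<Longrightarrow> rk N (F - {x}) = rk N F"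
    using F by (auto simp: nonempty_proper_cyclic_flats_iff[OF N])
  note c = expand_rk_cyclic_flat[OF F]
  have WE: "W \<subseteq> E" using F' W by blast
  have fin: "finite W" using WE finite_E finite_subset by blast
  have rkW: "rk (expand N D C) W = rk N F + card D" using rk_expand_cyclic_flat[OF F] W by simp
  have WN: "W \<inter> ground N = F" "W \<inter> C = {}" using F' disj W by auto
  have "rk (expand N D C) W < rk (expand N D C) (insert x W)" if x: "x \<in> E - W" for x
  proof -
    have "rk N F + card D < expand_bound N D C (insert x W)"
    proof (cases "x \<in> ground N")
      case True
      then have "insert x W \<inter> ground N = insert x F" using WN by auto
      then show ?thesis using F'(4)[of x] True x W unfolding expand_bound_def by simp
    next
      case False
      then have "x \<in> C" using x W by blast
      then have "insert x W \<inter> ground N = F" "insert x W \<inter> C = {x}" using WN False by auto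
      then show ?thesis unfolding expand_bound_def by simp
    qed
    moreover have "insert x W \<subseteq> E" using WE x by blast
    ultimately show ?thesis
      using c rkW W fin x rk_expand[of "insert x W"] unfolding expand_rk_def by simp
  qed
  moreover have "rk (expand N D C) (W - {x}) = rk (expand N D C) W" if x: "x \<in> W" for x
  proof -
    have "expand_bound N D C (W - {x}) = rk N F + card D"
    proof (cases "x \<in> ground N")
      case True
      then have "(W - {x}) \<inter> ground N = F - {x}" "(W - {x}) \<inter> C = {}" using WN by auto
      then show ?thesis using F'(5)[of x] True x W disj unfolding expand_bound_def by auto
    next
      case False
      then have "(W - {x}) \<inter> ground N = F" "(W - {x}) \<inter> C = {}" using WN by auto
      then show ?thesis unfolding expand_bound_def by simp
    qed
    moreover have "card W = card (W - {x}) + 1" using fin x by (metis Suc_eq_plus1 card_Suc_Diff1)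
    moreover have "rk (expand N D C) (W - {x}) =
        min (card (W - {x})) (min (rank N + card D) (expand_bound N D C (W - {x})))"
      using rk_expand[OF subset_trans[OF Diff_subset WE], of "{x}"] by (simp only: expand_rk_def)
    ultimately show ?thesis using c(2,3)[folded W] rkW by linarith
  qed
  moreover have "W \<noteq> {}" "W \<noteq> E" using F'(1,2) W WN(1) by blast+
  ultimately show "W \<in> nonempty_proper_cyclic_flats (expand N D C)"
    using WE by (simp add: nonempty_proper_cyclic_flats_iff[OF matroid_expand])
next
  fix W assume W: "W \<in> nonempty_proper_cyclic_flats (expand N D C)"
  let ?r = "rk (expand N D C)" and ?g = "expand_bound N D C"
  have W': "W \<noteq> {}" "W \<noteq> E" "W \<subseteq> E" "\<And>x. x \<in> E - W \<Longrightarrow> ?r W < ?r (insert x W)"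
    "\<And>x. x \<in> W \<Longrightarrow> ?r (W - {x}) = ?r W"
    using W by (auto simp: nonempty_proper_cyclic_flats_iff[OF matroid_expand])
  obtain y where y: "y \<in> E - W" using W' by blast
  have less: "?r W < card W" by (rule cyclic_flat_nullity_pos[OF matroid_expand W])
  have "?r (insert y W) \<le> rank N + card D"
    using rk_expand[of "insert y W"] expand_rk_le y W' by auto
  then have "?r W < rank N + card D" using W'(4)[OF y] by simp
  then have rW: "?r W = ?g W" using less rk_expand[OF W'(3)] unfolding expand_rk_def by auto
  have g_insert: "?g W < ?g (insert x W)" if "x \<in> E - W" for x
    using W'(4)[OF that] rW rk_expand[of "insert x W"] expand_rk_le(3)[of "insert x W"] that W'(3) by auto
  have g_remove: "?g (W - {x}) = ?g W" if "x \<in> W" for x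
  proof -
    have "?g W \<le> ?g (W - {x})"
      using W'(5)[OF that] rW rk_expand[OF subset_trans[OF Diff_subset W'(3)], of "{x}"]
        expand_rk_le(3)[of "W - {x}"] by simp
    then show ?thesis using expand_bound_mono[of "W - {x}" W] by auto
  qed
  define F where "F = W \<inter> ground N"
  have "x \<in> W" if x: "x \<in> D" for x
  proof (rule ccontr)
    assume "x \<notin> W"
    moreover have "insert x W \<inter> ground N = W \<inter> ground N" "insert x W \<inter> C = W \<inter> C" using x disj by auto
    ultimately show False using g_insert[of x] x unfolding expand_bound_def by auto
  qed
  moreover have "x \<notin> C" if x: "x \<in> W" for x
  proof
    assume "x \<in> C"
    then have "(W - {x}) \<inter> ground N = W \<inter> ground N" "card ((W - {x}) \<inter> C) < card (W \<inter> C)"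
      using x disj finite_C by (auto intro!: psubset_card_mono)
    then show False using g_remove[OF x] unfolding expand_bound_def by simp
  qed
  ultimately have WF: "W = F \<union> D" "W \<inter> C = {}" using W'(3) unfolding F_def by auto
  have gW: "?g W = rk N F + card D" unfolding expand_bound_def F_def WF(2) by simp
  have "rk N F < rk N (insert x F)" if x: "x \<in> ground N - F" for x
  proof -
    have "x \<in> E - W" using x F_def by blast
    moreover have "insert x W \<inter> ground N = insert x F" "insert x W \<inter> C = {}"
      using x WF disj unfolding F_def by auto
    ultimately show ?thesis using g_insert[of x] gW unfolding expand_bound_def by simp
  qed
  moreover have "rk N (F - {x}) = rk N F" if x: "x \<in> F" for x
  proof -
    have "x \<in> W" "(W - {x}) \<inter> ground N = F - {x}" "(W - {x}) \<inter> C = {}" using x WF unfolding F_def by auto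
    then show ?thesis using g_remove[of x] gW unfolding expand_bound_def by simp
  qed
  moreover have "F \<noteq> {}" using less rW gW WF by auto
  moreover have "F \<noteq> ground N" using \<open>?r W < rank N + card D\<close> rW gW by auto
  moreover have "F \<subseteq> ground N" unfolding F_def by blast
  ultimately have "F \<in> nonempty_proper_cyclic_flats N"
    by (simp add: nonempty_proper_cyclic_flats_iff[OF N])
  then show "W \<in> {F \<union> D | F. F \<in> nonempty_proper_cyclic_flats N}" using WF by blast
qed

lemma total_nullity_expand: "total_nullity (expand N D C) \<le> total_nullity N"
  unfolding total_nullity_def
proof (rule sum_le_included[where i = "\<lambda>F. F \<union> D"])
  show "\<forall>W\<in>nonempty_proper_cyclic_flats (expand N D C). \<exists>F\<in>nonempty_proper_cyclic_flats N.
      F \<union> D = W \<and> card W - rk (expand N D C) W \<le> card F - rk N F"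
  proof
    fix W assume "W \<in> nonempty_proper_cyclic_flats (expand N D C)"
    then obtain F where F: "F \<in> nonempty_proper_cyclic_flats N" "W = F \<union> D"
      unfolding nonempty_proper_cyclic_flats_expand by blast
    have "card W \<le> card F + card D" using F by (simp add: card_Un_le)
    then have "card W - rk (expand N D C) W \<le> card F - rk N F"
      using rk_expand_cyclic_flat[OF F(1)] F(2) by simp
    then show "\<exists>F\<in>nonempty_proper_cyclic_flats N.
      F \<union> D = W \<and> card W - rk (expand N D C) W \<le> card F - rk N F" using F by blast
  qed
qed (use finite_nonempty_proper_cyclic_flats N matroid_expand in auto)

text \<open>Outside \<open>C \<union> FI N\<close> every element lies in a cyclic flat
  \<open>F \<union> D\<close>; for elements of \<open>D\<close> this requires that \<open>N\<close>
  has some \<open>F\<close> at all. Deleting such an element pushes the total nullity below that of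
  \<open>N\<close>.\<close>

lemma deleted_element:
  assumes ne: "nonempty_proper_cyclic_flats N \<noteq> {}"
    and XY: "X \<subseteq> E" "X \<inter> Y = {}" "e \<in> Y" "e \<in> E"
    and iso: "isomorphic (delete (contract (expand N D C) X) Y) N"
  shows "e \<in> C \<union> FI N"
proof (rule ccontr)
  assume e: "e \<notin> C \<union> FI N"
  have "\<exists>F\<in>nonempty_proper_cyclic_flats N. e \<in> F \<union> D"
  proof (cases "e \<in> D")
    case False
    then have "e \<in> ground N" using e XY by blast
    then obtain F where "F \<in> cyclic_flats N" "F \<noteq> ground N" "e \<in> F"
      using e unfolding FI_def by blast
    then show ?thesis unfolding nonempty_proper_cyclic_flats_def by blast
  qed (use ne in blast)
  then obtain W where W: "W \<in> nonempty_proper_cyclic_flats (expand N D C)" "e \<in> W"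
    unfolding nonempty_proper_cyclic_flats_expand by blast
  have "total_nullity N \<le> total_nullity (delete (contract (expand N D C) X) Y)"
    by (rule total_nullity_isomorphic[OF iso matroid_minor[OF matroid_expand] N])
  also have "\<dots> < total_nullity (expand N D C)"
    by (rule total_nullity_minor_less[OF matroid_expand _ XY(2,3) W(2,1)]) (use XY in simp)
  also have "\<dots> \<le> total_nullity N" by (rule total_nullity_expand)
  finally show False by simp
qed

lemma contracted_element:
  assumes ne: "nonempty_proper_cyclic_flats N \<noteq> {}"
    and XY: "Y \<subseteq> E" "X \<inter> Y = {}" "e \<in> X" "e \<in> E"
    and iso: "isomorphic (delete (contract (expand N D C) X) Y) N"
  shows "e \<in> D \<union> FI (dual N)"
proof -
  interpret dual: expansion "dual N" C D by (rule expansion_dual)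
  have "dual (delete (contract (expand N D C) X) Y) = contract (delete (expand (dual N) C D) X) Y"
    by (simp add: dual_minor dual_expand)
  also have "\<dots> = delete (contract (expand (dual N) C D) Y) X"
    using XY by (intro delete_contract_commute[symmetric] dual.matroid_expand) auto
  finally have "isomorphic (delete (contract (expand (dual N) C D) Y) X) (dual N)"
    using isomorphic_dual[OF iso matroid_minor[OF matroid_expand] N] by simp
  moreover have "nonempty_proper_cyclic_flats (dual N) \<noteq> {}"
    using ne nonempty_proper_cyclic_flats_dual[OF N] by blast
  ultimately show ?thesis using dual.deleted_element[of Y X e] XY by auto
qed

end

lemma FI_eq_ground:
  assumes "nonempty_proper_cyclic_flats M = {}"
  shows "FI M = ground M"
  using assms unfolding FI_def nonempty_proper_cyclic_flats_def by blast

text \<open>Without such flats, neither \<open>N\<close> nor its dual has any, and every element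
  would lie in both \<open>FI N\<close> and \<open>FI (dual N)\<close>.\<close>

lemma nonempty_proper_cyclic_flats_nonempty:
  assumes N: "matroid N" and "ground N \<noteq> {}" "FI N \<inter> FI (dual N) = {}"
  shows "nonempty_proper_cyclic_flats N \<noteq> {}"
proof
  assume none: "nonempty_proper_cyclic_flats N = {}"
  then have "nonempty_proper_cyclic_flats (dual N) = {}"
    using nonempty_proper_cyclic_flats_dual[OF matroid_dual[OF N]] dual_dual[OF N] by auto
  then show False using FI_eq_ground[OF none] FI_eq_ground[of "dual N"] assms by simp
qed

section \<open>The minimum of two rank functions\<close>

definition meet :: "'a mat \<Rightarrow> 'a mat \<Rightarrow> 'a mat" where
  "meet Q1 Q2 = mat_of_rank (ground Q1) (\<lambda>X. min (rk Q1 X) (rk Q2 X))"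

lemma ground_meet [simp]: "ground (meet Q1 Q2) = ground Q1"
  by (simp add: meet_def)

lemma meet_commute: "ground Q1 = ground Q2 \<Longrightarrow> meet Q1 Q2 = meet Q2 Q1"
  by (simp add: meet_def min.commute)

text \<open>Read \<open>cross\<close> as
  \<open>(k - rk Q1 X) + (k - rk Q2 Y) + card (X \<inter> Y) \<le> s\<close>: sets that are
  dependent and not spanning, one for each matroid, have almost full rank and a small
  intersection.\<close>

locale crossing_pair =
  fixes Q1 Q2 :: "'a mat" and k s :: nat
  assumes Q1: "matroid Q1" and Q2: "matroid Q2" and same_ground: "ground Q2 = ground Q1"
    and rank_Q1: "rank Q1 = k" and rank_Q2: "rank Q2 = k" and s_le: "s \<le> k"
    and cross: "\<And>X Y. X \<subseteq> ground Q1 \<Longrightarrow> Y \<subseteq> ground Q1 \<Longrightarrow> rk Q1 X < card X \<Longrightarrow> rk Q1 X < k \<Longrightarrow>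
      rk Q2 Y < card Y \<Longrightarrow> rk Q2 Y < k \<Longrightarrow> 2 * k + card (X \<inter> Y) \<le> rk Q1 X + rk Q2 Y + s"
begin

lemma crossing_pair_flip: "crossing_pair Q2 Q1 k s"
proof unfold_locales
  fix X Y assume "X \<subseteq> ground Q2" "Y \<subseteq> ground Q2" "rk Q2 X < card X" "rk Q2 X < k"
    "rk Q1 Y < card Y" "rk Q1 Y < k"
  then show "2 * k + card (X \<inter> Y) \<le> rk Q2 X + rk Q1 Y + s"
    using cross[of Y X] same_ground by (simp add: Int_commute add.commute)
qed (use Q1 Q2 same_ground rank_Q1 rank_Q2 s_le in auto)

lemma finite_below: "X \<subseteq> ground Q1 \<Longrightarrow> finite X"
  using matroid_finite[OF Q1] finite_subset by blast

lemma rk_le_k: "X \<subseteq> ground Q1 \<Longrightarrow> rk Q1 X \<le> k" "X \<subseteq> ground Q1 \<Longrightarrow> rk Q2 X \<le> k"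
  using rk_mono[OF Q1, of X "ground Q1"] rk_mono[OF Q2, of X "ground Q2"] rank_Q1 rank_Q2 same_ground by simp_all

text \<open>If one of the sets is independent or spanning in its matroid, monotonicity and unit
  increase suffice. Otherwise the left side is at most \<open>k + card (X \<inter> Y)\<close>, and
  \<open>cross\<close> with \<open>s \<le> k\<close> bounds this by the right side.\<close>

lemma mixed_submod:
  assumes X: "X \<subseteq> ground Q1" and Y: "Y \<subseteq> ground Q1"
  shows "min (rk Q1 (X \<union> Y)) (rk Q2 (X \<union> Y)) + min (rk Q1 (X \<inter> Y)) (rk Q2 (X \<inter> Y)) \<le> rk Q1 X + rk Q2 Y"
proof -
  have fin: "finite X" "finite Y" using X Y finite_below by blast+
  have le: "rk Q1 (X \<inter> Y) \<le> card (X \<inter> Y)" using fin by (intro rk_le_card[OF Q1]) simp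
  have le2: "rk Q2 (X \<inter> Y) \<le> card (X \<inter> Y)" using fin by (intro rk_le_card[OF Q2]) simp
  have un: "X \<union> (Y - X) = X \<union> Y" "Y \<union> (X - Y) = X \<union> Y" by auto
  have cX: "card X = card (X \<inter> Y) + card (X - Y)" using card_Int_Diff[OF fin(1)] .
  have cY: "card Y = card (X \<inter> Y) + card (Y - X)" using card_Int_Diff[OF fin(2), of X] by (simp add: Int_commute)
  have u1: "rk Q1 (X \<union> Y) \<le> rk Q1 X + card (Y - X)"
    using rk_Un_le_card[OF Q1, of "Y - X" X] fin unfolding un by simp
  have u2: "rk Q2 (X \<union> Y) \<le> rk Q2 Y + card (X - Y)"
    using rk_Un_le_card[OF Q2, of "X - Y" Y] fin unfolding un by simp
  have Un: "X \<union> Y \<subseteq> ground Q1" using X Y by blast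
  have m1: "rk Q1 (X \<inter> Y) \<le> rk Q1 X" and m2: "rk Q2 (X \<inter> Y) \<le> rk Q2 Y"
    by (rule rk_mono[OF Q1], blast) (rule rk_mono[OF Q2], blast)
  consider "rk Q1 X = card X" | "rk Q2 Y = card Y" | "rk Q1 X = k" | "rk Q2 Y = k"
    | "rk Q1 X < card X" "rk Q1 X < k" "rk Q2 Y < card Y" "rk Q2 Y < k"
    using rk_le_card[OF Q1 fin(1)] rk_le_card[OF Q2 fin(2)] rk_le_k(1)[OF X] rk_le_k(2)[OF Y] by linarith
  then show ?thesis
  proof cases
    case 5
    then show ?thesis using cross[OF X Y] s_le le rk_le_k[OF Un] by linarith
  qed (use le le2 cX cY u1 u2 m1 m2 rk_le_k[OF Un] in linarith)+
qed

lemma rank_function_meet: "rank_function (ground Q1) (\<lambda>X. min (rk Q1 X) (rk Q2 X))"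
proof (rule rank_functionI)
  show "finite (ground Q1)" by (rule matroid_finite[OF Q1])
  show "min (rk Q1 X) (rk Q2 X) \<le> card X" if "X \<subseteq> ground Q1" for X
    using rk_le_card[OF Q1 finite_below[OF that]] by simp
  show "min (rk Q1 X) (rk Q2 X) \<le> min (rk Q1 Y) (rk Q2 Y)" if "X \<subseteq> Y" for X Y
    using rk_mono[OF Q1 that] rk_mono[OF Q2 that] by linarith
  show "min (rk Q1 (X \<union> Y)) (rk Q2 (X \<union> Y)) + min (rk Q1 (X \<inter> Y)) (rk Q2 (X \<inter> Y)) \<le>
      min (rk Q1 X) (rk Q2 X) + min (rk Q1 Y) (rk Q2 Y)"
    if XY: "X \<subseteq> ground Q1" "Y \<subseteq> ground Q1" for X Y
  proof -
    have swap: "Y \<union> X = X \<union> Y" "Y \<inter> X = X \<inter> Y" by auto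
    show ?thesis
      using mixed_submod[OF XY] mixed_submod[OF XY(2,1), unfolded swap]
        rk_submod[OF Q1, of X Y] rk_submod[OF Q2, of X Y]
      by linarith
  qed
qed

lemma matroid_meet: "matroid (meet Q1 Q2)"
  unfolding meet_def by (rule matroid_mat_of_rank[OF rank_function_meet])

lemma rk_meet: "X \<subseteq> ground Q1 \<Longrightarrow> rk (meet Q1 Q2) X = min (rk Q1 X) (rk Q2 X)"
  unfolding meet_def by (rule rk_mat_of_rank[OF rank_function_meet])

lemma indep_meet: "X \<in> indeps (meet Q1 Q2) \<longleftrightarrow> X \<in> indeps Q1 \<and> X \<in> indeps Q2"
proof (cases "X \<subseteq> ground Q1")
  case True
  then show ?thesis
    using rk_meet[OF True] same_ground rk_le_card[OF Q1 finite_below[OF True]] rk_le_card[OF Q2 finite_below[OF True]]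
    by (auto simp: indep_iff_rk[OF matroid_meet] indep_iff_rk[OF Q1] indep_iff_rk[OF Q2])
qed (auto simp: indep_iff_rk[OF matroid_meet] indep_iff_rk[OF Q1])

lemma cyclic_flat_first:
  assumes W: "W \<in> nonempty_proper_cyclic_flats Q1"
  shows "W \<in> nonempty_proper_cyclic_flats (meet Q1 Q2)" "rk (meet Q1 Q2) W = rk Q1 W"
proof -
  have W': "W \<noteq> {}" "W \<noteq> ground Q1" "W \<subseteq> ground Q1"
    "\<And>x. x \<in> ground Q1 - W \<Longrightarrow> rk Q1 W < rk Q1 (insert x W)" "\<And>x. x \<in> W \<Longrightarrow> rk Q1 (W - {x}) = rk Q1 W"
    using W by (auto simp: nonempty_proper_cyclic_flats_iff[OF Q1])
  obtain y where y: "y \<in> ground Q1 - W" using W' by blast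
  have less: "rk Q1 W < card W" by (rule cyclic_flat_nullity_pos[OF Q1 W])
  have "insert y W \<subseteq> ground Q1" using y W' by blast
  then have less_k: "rk Q1 W < k" using W'(4)[OF y] rk_le_k(1)[of "insert y W"] by linarith
  \<comment> \<open>By \<open>cross\<close> with both sets equal to \<open>W\<close>. The margin of
    one is what keeps \<open>Q1\<close> decisive after an element is removed from
    \<open>W\<close>.\<close>
  have gt: "rk Q1 W < rk Q2 W"
  proof (rule ccontr)
    assume neg: "\<not> ?thesis"
    then have "2 * k + card (W \<inter> W) \<le> rk Q1 W + rk Q2 W + s"
      using less less_k by (intro cross W'(3)) auto
    then show False using less less_k s_le neg by simp
  qed
  show rk: "rk (meet Q1 Q2) W = rk Q1 W" using rk_meet[OF W'(3)] gt by simp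
  have "rk (meet Q1 Q2) W < rk (meet Q1 Q2) (insert x W)" if x: "x \<in> ground Q1 - W" for x
  proof -
    have "rk Q2 W \<le> rk Q2 (insert x W)" by (rule rk_mono[OF Q2]) blast
    moreover have "insert x W \<subseteq> ground Q1" using x W' by blast
    ultimately show ?thesis using rk rk_meet[of "insert x W"] W'(4)[OF x] gt by simp
  qed
  moreover have "rk (meet Q1 Q2) (W - {x}) = rk (meet Q1 Q2) W" if x: "x \<in> W" for x
  proof -
    have "rk Q2 W \<le> rk Q2 (W - {x}) + 1"
      using rk_insert_le[OF Q2, of x "W - {x}"] x by (simp add: insert_absorb)
    moreover have "W - {x} \<subseteq> ground Q1" using W' by blast
    ultimately show ?thesis using rk rk_meet[of "W - {x}"] W'(5)[OF x] gt by simp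
  qed
  ultimately show "W \<in> nonempty_proper_cyclic_flats (meet Q1 Q2)"
    using W'(1-3) by (simp add: nonempty_proper_cyclic_flats_iff[OF matroid_meet])
qed

text \<open>The minimum agrees with \<open>rk Q1\<close> at \<open>W\<close> and is at most
  \<open>rk Q1\<close> elsewhere, so both rank conditions pass from the minimum to
  \<open>Q1\<close>.\<close>

lemma cyclic_flat_meet_first:
  assumes W: "W \<in> nonempty_proper_cyclic_flats (meet Q1 Q2)" and le: "rk Q1 W \<le> rk Q2 W"
  shows "W \<in> nonempty_proper_cyclic_flats Q1"
proof -
  let ?r = "rk (meet Q1 Q2)"
  have W': "W \<noteq> {}" "W \<noteq> ground Q1" "W \<subseteq> ground Q1"
    "\<And>x. x \<in> ground Q1 - W \<Longrightarrow> ?r W < ?r (insert x W)" "\<And>x. x \<in> W \<Longrightarrow> ?r (W - {x}) = ?r W"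
    using W by (auto simp: nonempty_proper_cyclic_flats_iff[OF matroid_meet])
  have eq: "?r W = rk Q1 W" using rk_meet[OF W'(3)] le by simp
  have "rk Q1 W < rk Q1 (insert x W)" if x: "x \<in> ground Q1 - W" for x
  proof -
    have "insert x W \<subseteq> ground Q1" using x W' by blast
    then show ?thesis using W'(4)[OF x] eq rk_meet[of "insert x W"] by simp
  qed
  moreover have "rk Q1 (W - {x}) = rk Q1 W" if x: "x \<in> W" for x
  proof -
    have "W - {x} \<subseteq> ground Q1" using W' by blast
    then have "rk Q1 W \<le> rk Q1 (W - {x})" using W'(5)[OF x] eq rk_meet[of "W - {x}"] by simp
    moreover have "rk Q1 (W - {x}) \<le> rk Q1 W" by (rule rk_mono[OF Q1]) blast
    ultimately show ?thesis by simp
  qed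
  ultimately show ?thesis using W'(1-3) by (simp add: nonempty_proper_cyclic_flats_iff[OF Q1])
qed

lemma nonempty_proper_cyclic_flats_meet:
  "nonempty_proper_cyclic_flats (meet Q1 Q2) = nonempty_proper_cyclic_flats Q1 \<union> nonempty_proper_cyclic_flats Q2"
proof -
  interpret flip: crossing_pair Q2 Q1 k s by (rule crossing_pair_flip)
  have "meet Q2 Q1 = meet Q1 Q2" using same_ground by (rule meet_commute)
  then show ?thesis
    using cyclic_flat_first(1) cyclic_flat_meet_first flip.cyclic_flat_first(1) flip.cyclic_flat_meet_first nle_le
    by (metis subsetI subset_antisym UnE UnI1 UnI2)
qed

text \<open>If both rank bounds were active above \<open>X\<close>, the crossing inequality would fail at the two
  sets witnessing this.\<close>

lemma minor_meet_cases:
  assumes X: "X \<in> indeps (meet Q1 Q2)" and r: "card X + r = k" "s + r \<le> k"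
  shows "delete (contract (meet Q1 Q2) X) Y = delete (contract Q1 X) Y \<or>
    delete (contract (meet Q1 Q2) X) Y = delete (contract Q2 X) Y"
proof -
  have X1: "X \<in> indeps Q1" and X2: "X \<in> indeps Q2" using X indep_meet by blast+
  have False if Z: "Z1 \<union> X \<in> indeps Q1" "Z1 \<union> X \<notin> indeps Q2" "Z2 \<union> X \<in> indeps Q2" "Z2 \<union> X \<notin> indeps Q1"
    for Z1 Z2
  proof -
    have sub: "Z1 \<union> X \<subseteq> ground Q1" "Z2 \<union> X \<subseteq> ground Q1"
      using indep_subset_ground[OF Q1 Z(1)] indep_subset_ground[OF Q2 Z(3)] same_ground by simp_all
    have c: "card (Z1 \<union> X) \<le> k" "card (Z2 \<union> X) \<le> k"
      using rk_indep[OF Q1 Z(1)] rk_indep[OF Q2 Z(3)] rk_le_k sub by metis+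
    have l: "rk Q2 (Z1 \<union> X) < card (Z1 \<union> X)" "rk Q1 (Z2 \<union> X) < card (Z2 \<union> X)"
      using Z sub same_ground rk_le_card[OF Q1 finite_below] rk_le_card[OF Q2 finite_below]
      by (simp_all add: indep_iff_rk[OF Q1] indep_iff_rk[OF Q2] order_less_le)
    \<comment> \<open>Both ranks are below \<open>k\<close> and both sets contain \<open>X\<close>,
      so this would force \<open>card X < s\<close>, whereas
      \<open>card X = k - r \<ge> s\<close>.\<close>
    have "2 * k + card ((Z2 \<union> X) \<inter> (Z1 \<union> X)) \<le> rk Q1 (Z2 \<union> X) + rk Q2 (Z1 \<union> X) + s"
      by (rule cross) (use sub c l in auto)
    moreover have "card X \<le> card ((Z2 \<union> X) \<inter> (Z1 \<union> X))"
      using finite_below sub by (intro card_mono) auto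
    ultimately show False using c l r by linarith
  qed
  \<comment> \<open>So the independent sets through \<open>X\<close> of one matroid are among those
    of the other. As independence in the meet is independence in both, the smaller family alone
    describes the minor.\<close>
  then consider "\<And>Z. Z \<union> X \<in> indeps Q1 \<Longrightarrow> Z \<union> X \<in> indeps Q2" | "\<And>Z. Z \<union> X \<in> indeps Q2 \<Longrightarrow> Z \<union> X \<in> indeps Q1"
    by blast
  then show ?thesis
  proof cases
    case 1
    then have "delete (contract (meet Q1 Q2) X) Y = delete (contract Q1 X) Y"
      by (intro mat.equality set_eqI) (auto simp: indep_minor[OF matroid_meet X] indep_minor[OF Q1 X1] indep_meet)
    then show ?thesis by blast
  next
    case 2
    then have "delete (contract (meet Q1 Q2) X) Y = delete (contract Q2 X) Y"
      by (intro mat.equality set_eqI)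
        (auto simp: indep_minor[OF matroid_meet X] indep_minor[OF Q2 X2] indep_meet same_ground)
    then show ?thesis by blast
  qed
qed

end

section \<open>The construction\<close>

context expansion
begin

lemma rk_expand_singleton:
  assumes "D \<noteq> {}" "x \<in> E"
  shows "rk (expand N D C) {x} = 1"
proof -
  have "card D > 0" using assms finite_D by (simp add: card_gt_0_iff)
  then show ?thesis using rk_expand[of "{x}"] assms unfolding expand_rk_def expand_bound_def by simp
qed

lemma rk_expand_remove:
  assumes "C \<noteq> {}"
  shows "rk (expand N D C) (E - {x}) = rank N + card D"
proof -
  have cC: "card C > 0" using assms finite_C by (simp add: card_gt_0_iff)
  have E: "E \<inter> ground N = ground N" "E \<inter> D = D" "E \<inter> C = C" by auto
  have "rank N \<le> card (ground N)" by (rule rk_le_card[OF N matroid_finite[OF N]])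
  then have "rank N + card D + 1 \<le> card E" using card_split[of E] E cC by simp
  then have c: "rank N + card D \<le> card (E - {x})"
    using finite_E by (cases "x \<in> E") (simp_all del: Un_iff)
  have g: "rank N + card D \<le> expand_bound N D C (E - {x})"
  proof (cases "x \<in> C")
    case True
    then have "(E - {x}) \<inter> ground N = ground N" using disj by auto
    then show ?thesis unfolding expand_bound_def by simp
  next
    case False
    then have "(E - {x}) \<inter> C = C" "(E - {x}) \<inter> ground N = ground N - {x}" by auto
    moreover have "ground N \<subseteq> insert x (ground N - {x})" by blast
    then have "rank N \<le> rk N (ground N - {x}) + 1"
      using rk_mono[OF N] rk_insert_le[OF N] by (meson order_trans)
    ultimately show ?thesis using cC unfolding expand_bound_def by simp
  qed
  show ?thesis using rk_expand[of "E - {x}"] c g unfolding expand_rk_def by simp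
qed

end

text \<open>With \<open>s\<close> the sum of the sizes of the two ground sets, \<open>large1\<close>
  yields \<open>s + rank N1 \<le> k\<close> and \<open>large2\<close> yields
  \<open>s + rank N2 \<le> k\<close>, the condition for comparing minors. The sizes of
  \<open>U1\<close> and \<open>U2\<close> are given by sums to avoid truncated subtraction.\<close>

locale construction =
  fixes N1 N2 :: "'a mat" and A1 A2 U1 U2 :: "'a set" and k :: nat
  assumes N1: "matroid N1" and N2: "matroid N2" and pos1: "rank N1 > 0" and pos2: "rank N2 > 0"
    and disj: "ground N1 \<inter> ground N2 = {}" "U1 \<inter> U2 = {}"
      "U1 \<inter> (ground N1 \<union> ground N2) = {}" "U2 \<inter> (ground N1 \<union> ground N2) = {}"
    and A1: "A1 \<subseteq> ground N1" and A2: "A2 \<subseteq> ground N2"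
    and fin: "finite U1" "finite U2"
    and card_U1: "card U1 + card A2 + rank N1 = k" and card_U2: "card U2 + card A1 + rank N2 = k"
    and large1: "2 * card (ground N1) + card (ground N2) \<le> k"
    and large2: "card (ground N1) + 2 * card (ground N2) \<le> k"
begin

abbreviation "Q1 \<equiv> expand N1 (U1 \<union> A2) (U2 \<union> (ground N2 - A2))"
abbreviation "Q2 \<equiv> expand N2 (U2 \<union> A1) (U1 \<union> (ground N1 - A1))"
abbreviation "M \<equiv> meet Q1 Q2"

lemma construction_flip: "construction N2 N1 A2 A1 U2 U1 k"
  using N1 N2 pos1 pos2 disj A1 A2 fin card_U1 card_U2 large1 large2
  by (intro construction.intro) (simp_all add: Int_commute Un_commute)

lemma expansion1: "expansion N1 (U1 \<union> A2) (U2 \<union> (ground N2 - A2))"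
proof
  show "finite (U1 \<union> A2)" "finite (U2 \<union> (ground N2 - A2))"
    using fin A2 matroid_finite[OF N2] finite_subset by auto
qed (use N1 disj A2 in auto)

end

sublocale construction \<subseteq> e1: expansion N1 "U1 \<union> A2" "U2 \<union> (ground N2 - A2)"
  by (rule expansion1)

sublocale construction \<subseteq> e2: expansion N2 "U2 \<union> A1" "U1 \<union> (ground N1 - A1)"
  by (rule construction.expansion1[OF construction_flip])

context construction
begin

lemma rank_le_card: "rank N1 \<le> card (ground N1)" "rank N2 \<le> card (ground N2)"
  using rk_le_card[OF N1 matroid_finite[OF N1]] rk_le_card[OF N2 matroid_finite[OF N2]] .

lemma card_A: "card A1 \<le> card (ground N1)" "card A2 \<le> card (ground N2)"
  using card_mono[OF matroid_finite[OF N1] A1] card_mono[OF matroid_finite[OF N2] A2] .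

lemma card_D1: "card (U1 \<union> A2) = card U1 + card A2"
  using fin A2 disj matroid_finite[OF N2] by (intro card_Un_disjoint) (auto intro: finite_subset)

lemma card_D2: "card (U2 \<union> A1) = card U2 + card A1"
  using fin A1 disj matroid_finite[OF N1] by (intro card_Un_disjoint) (auto intro: finite_subset)

lemma rank_Q1: "rank Q1 = k" and rank_Q2: "rank Q2 = k"
  using e1.rank_expand e2.rank_expand card_D1 card_D2 card_U1 card_U2 by simp_all

lemma ground_Q: "ground Q1 = ground N1 \<union> ground N2 \<union> U1 \<union> U2" "ground Q2 = ground N1 \<union> ground N2 \<union> U1 \<union> U2"
  using A1 A2 by auto

text \<open>Both ranks are given by the third term. As the nullity of
  \<open>X \<inter> ground N1\<close> is at most that of \<open>N1\<close>, this yields \<open>k +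
  card (X \<inter> ground N1) + card (X \<inter> U2) \<le> rk Q1 X + card (ground N1)\<close>. Add
  the symmetric inequality for \<open>Y\<close>: the four sets counted cover
  \<open>X \<inter> Y\<close>.\<close>

lemma cross:
  assumes X: "X \<subseteq> ground Q1" "rk Q1 X < card X" "rk Q1 X < k"
    and Y: "Y \<subseteq> ground Q1" "rk Q2 Y < card Y" "rk Q2 Y < k"
  shows "2 * k + card (X \<inter> Y) \<le> rk Q1 X + rk Q2 Y + (card (ground N1) + card (ground N2))"
proof -
  let ?R1 = "ground N1" and ?R2 = "ground N2"
  have "rk Q1 X = expand_bound N1 (U1 \<union> A2) (U2 \<union> (?R2 - A2)) X"
    using X e1.rk_expand[of X] card_D1 card_U1 unfolding expand_rk_def by auto
  then have r1: "rk N1 (X \<inter> ?R1) + (card U1 + card A2) + card (X \<inter> U2) \<le> rk Q1 X"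
    unfolding expand_bound_def card_D1
    using card_mono[of "X \<inter> (U2 \<union> (?R2 - A2))" "X \<inter> U2"] e1.finite_C by auto
  have "Y \<subseteq> ground Q2" using Y(1) ground_Q by simp
  then have "rk Q2 Y = expand_bound N2 (U2 \<union> A1) (U1 \<union> (?R1 - A1)) Y"
    using Y e2.rk_expand[of Y] card_D2 card_U2 unfolding expand_rk_def by auto
  then have r2: "rk N2 (Y \<inter> ?R2) + (card U2 + card A1) + card (Y \<inter> U1) \<le> rk Q2 Y"
    unfolding expand_bound_def card_D2
    using card_mono[of "Y \<inter> (U1 \<union> (?R1 - A1))" "Y \<inter> U1"] e2.finite_C by auto
  have n1: "card (X \<inter> ?R1) + rank N1 \<le> card ?R1 + rk N1 (X \<inter> ?R1)"
    by (rule nullity_mono[OF N1]) (auto simp: matroid_finite[OF N1])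
  have n2: "card (Y \<inter> ?R2) + rank N2 \<le> card ?R2 + rk N2 (Y \<inter> ?R2)"
    by (rule nullity_mono[OF N2]) (auto simp: matroid_finite[OF N2])
  have "X \<inter> Y \<subseteq> (X \<inter> ?R1) \<union> (Y \<inter> ?R2) \<union> (X \<inter> U2) \<union> (Y \<inter> U1)"
    using X(1) unfolding ground_Q by blast
  moreover have "finite ((X \<inter> ?R1) \<union> (Y \<inter> ?R2) \<union> (X \<inter> U2) \<union> (Y \<inter> U1))"
    using fin matroid_finite[OF N1] matroid_finite[OF N2] by blast
  ultimately have "card (X \<inter> Y) \<le> card ((X \<inter> ?R1) \<union> (Y \<inter> ?R2) \<union> (X \<inter> U2) \<union> (Y \<inter> U1))"
    by (rule card_mono[rotated])
  also have "\<dots> \<le> card (X \<inter> ?R1) + card (Y \<inter> ?R2) + card (X \<inter> U2) + card (Y \<inter> U1)"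
    by (meson add_le_mono1 card_Un_le order_trans)
  finally show ?thesis using r1 r2 n1 n2 card_U1 card_U2 by linarith
qed

end

sublocale construction \<subseteq> crossing_pair Q1 Q2 k "card (ground N1) + card (ground N2)"
proof
  show "ground Q2 = ground Q1" using ground_Q by simp
  show "card (ground N1) + card (ground N2) \<le> k" using large1 by simp
qed (use e1.matroid_expand e2.matroid_expand rank_Q1 rank_Q2 cross in auto)

context construction
begin

lemma ground_M: "ground M = ground N1 \<union> ground N2 \<union> U1 \<union> U2"
  using ground_Q by simp

lemma rank_M: "rank M = k"
  using rk_meet[of "ground Q1"] rank_Q1 rank_Q2 same_ground by simp

lemma nonempty_U: "U1 \<noteq> {}" "U2 \<noteq> {}"
  using card_U1 card_U2 large1 large2 rank_le_card card_A pos1 pos2 by auto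

text \<open>\<open>M\<close> has no loops, and by the next lemma no isthmuses. So \<open>{}\<close>
  and the ground set are cyclic flats, and a single element can be prescribed as contracted or as
  deleted in the normal form of a minor.\<close>

lemma rk_M_singleton:
  assumes "x \<in> ground M"
  shows "rk M {x} = 1"
proof -
  have x: "x \<in> ground Q1" "x \<in> ground Q2" using assms same_ground by simp_all
  have "rk Q1 {x} = 1" using e1.rk_expand_singleton[of x] nonempty_U x by simp
  moreover have "rk Q2 {x} = 1" using e2.rk_expand_singleton[of x] nonempty_U x(2)[simplified] by simp
  ultimately show ?thesis using rk_meet[of "{x}"] x by simp
qed

lemma rk_M_remove: "rk M (ground M - {x}) = k"
proof -
  have "rk Q1 (ground Q1 - {x}) = k" using e1.rk_expand_remove[of x] nonempty_U card_D1 card_U1 by simp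
  moreover have "rk Q2 (ground Q2 - {x}) = k" using e2.rk_expand_remove[of x] nonempty_U card_D2 card_U2 by simp
  ultimately show ?thesis using rk_meet[of "ground Q1 - {x}"] same_ground by simp
qed

lemma cyclic_flats_M: "cyclic_flats M = {{}, ground M} \<union> nonempty_proper_cyclic_flats M"
proof -
  have "rk M {} = 0" using rk_le_card[OF matroid_meet, of "{}"] by simp
  then have "{} \<in> cyclic_flats M" using rk_M_singleton by (simp add: cyclic_flats_iff[OF matroid_meet])
  moreover have "ground M \<in> cyclic_flats M"
    using rk_M_remove rank_M by (simp add: cyclic_flats_iff[OF matroid_meet])
  ultimately show ?thesis unfolding nonempty_proper_cyclic_flats_def by blast
qed

lemma is_M_construction_M: "is_M_construction k N1 A1 U1 N2 A2 U2 M"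
proof -
  have "rk M (F \<union> U1 \<union> A2) = rk N1 F + card U1 + card A2" if F: "F \<in> nonempty_proper_cyclic_flats N1" for F
  proof -
    have "F \<union> (U1 \<union> A2) \<in> nonempty_proper_cyclic_flats Q1"
      using F e1.nonempty_proper_cyclic_flats_expand by blast
    then show ?thesis
      using cyclic_flat_first(2) e1.rk_expand_cyclic_flat[OF F] card_D1 by (simp add: Un_assoc)
  qed
  moreover have "rk M (F \<union> U2 \<union> A1) = rk N2 F + card U2 + card A1" if F: "F \<in> nonempty_proper_cyclic_flats N2" for F
  proof -
    interpret flip: crossing_pair Q2 Q1 k "card (ground N1) + card (ground N2)" by (rule crossing_pair_flip)
    have "F \<union> (U2 \<union> A1) \<in> nonempty_proper_cyclic_flats Q2"
      using F e2.nonempty_proper_cyclic_flats_expand by blast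
    then show ?thesis
      using flip.cyclic_flat_first(2) meet_commute[OF same_ground] e2.rk_expand_cyclic_flat[OF F] card_D2
      by (simp add: Un_assoc)
  qed
  moreover have "rk M {} = 0" using rk_le_card[OF matroid_meet, of "{}"] by simp
  moreover have "cyclic_flats M = {{}, ground M} \<union>
      {F \<union> U1 \<union> A2 | F. F \<in> nonempty_proper_cyclic_flats N1} \<union>
      {F \<union> U2 \<union> A1 | F. F \<in> nonempty_proper_cyclic_flats N2}"
    unfolding cyclic_flats_M nonempty_proper_cyclic_flats_meet
      e1.nonempty_proper_cyclic_flats_expand e2.nonempty_proper_cyclic_flats_expand
    by (simp add: Un_assoc)
  ultimately show ?thesis
    unfolding is_M_construction_def using matroid_meet ground_M rank_M by blast
qed

text \<open>The specification fixes all cyclic flats and their ranks, and these determine a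
  matroid.\<close>

lemma M_construction_eq: "M_construction k N1 A1 U1 N2 A2 U2 = M"
  unfolding M_construction_def
proof (rule the_equality)
  show "is_M_construction k N1 A1 U1 N2 A2 U2 M" by (rule is_M_construction_M)
  fix M' assume M': "is_M_construction k N1 A1 U1 N2 A2 U2 M'"
  note M = is_M_construction_M[unfolded is_M_construction_def]
  note M' = M'[unfolded is_M_construction_def]
  show "M' = M"
  proof (rule matroid_eqI_cyclic_flats)
    show "matroid M'" "matroid M" using M M' by blast+
    show g: "ground M' = ground M" using M M' by argo
    show c: "cyclic_flats M' = cyclic_flats M" using M M' g by argo
    fix F assume "F \<in> cyclic_flats M'"
    then consider "F = {}" | "F = ground M'"
      | F1 where "F1 \<in> nonempty_proper_cyclic_flats N1" "F = F1 \<union> U1 \<union> A2"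
      | F2 where "F2 \<in> nonempty_proper_cyclic_flats N2" "F = F2 \<union> U2 \<union> A1"
      using M' by blast
    then show "rk M' F = rk M F"
    proof cases
      case 1 then show ?thesis using M M' by argo
    next
      case 2 then show ?thesis using M M' g by argo
    next
      case 3 then show ?thesis using M M' by simp
    next
      case 4 then show ?thesis using M M' by simp
    qed
  qed
qed

text \<open>Sets containing \<open>U1 \<union> A2\<close> contain the large set \<open>U1\<close> of
  free elements of \<open>Q2\<close>, which lifts the third term of \<open>Q2\<close> to at least
  \<open>k\<close>. So \<open>Q1\<close> decides the ranks, and contracting its coextension elements
  gives \<open>N1\<close>.\<close>

lemma minor_N1: "delete (contract M (U1 \<union> A2)) (U2 \<union> (ground N2 - A2)) = N1"
proof (rule matroid_eqI)
  let ?D = "U1 \<union> A2" and ?C = "U2 \<union> (ground N2 - A2)"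
  show g: "ground (delete (contract M ?D) ?C) = ground N1" using disj A2 by auto
  have eq: "rk M (Z \<union> ?D) = rk N1 Z + card ?D" if Z: "Z \<subseteq> ground N1" for Z
  proof -
    have sub: "Z \<union> ?D \<subseteq> ground Q1" using Z by auto
    have finZ: "finite (Z \<union> ?D)" using sub finite_below by blast
    have "card (Z \<union> ?D) = card Z + card ?D"
      using Z e1.disj finZ by (intro card_Un_disjoint) auto
    moreover have "rk N1 Z \<le> card Z" using finZ by (intro rk_le_card[OF N1]) simp
    moreover have "rk N1 Z \<le> rank N1" by (rule rk_mono[OF N1 Z])
    moreover have "(Z \<union> ?D) \<inter> ground N1 = Z" "(Z \<union> ?D) \<inter> ?C = {}" using Z e1.disj by auto
    ultimately have r1: "rk Q1 (Z \<union> ?D) = rk N1 Z + card ?D"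
      using e1.rk_expand[of "Z \<union> ?D"] sub unfolding expand_rk_def expand_bound_def by simp
    have "card U1 \<le> card ((Z \<union> ?D) \<inter> (U1 \<union> (ground N1 - A1)))"
      using finZ by (intro card_mono) auto
    then have "k \<le> expand_bound N2 (U2 \<union> A1) (U1 \<union> (ground N1 - A1)) (Z \<union> ?D)"
      using card_U1 card_U2 card_D2 large2 rank_le_card card_A unfolding expand_bound_def by linarith
    moreover have "rank N2 + card (U2 \<union> A1) = k" using card_D2 card_U2 by simp
    ultimately have "rk Q2 (Z \<union> ?D) = min (card (Z \<union> ?D)) k"
      using e2.rk_expand[of "Z \<union> ?D"] sub same_ground unfolding expand_rk_def by simp
    moreover have "rk Q1 (Z \<union> ?D) \<le> card (Z \<union> ?D)" by (rule rk_le_card[OF Q1 finZ])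
    ultimately show ?thesis using r1 rk_meet[OF sub] rk_le_k(1)[OF sub] by simp
  qed
  fix Z assume "Z \<subseteq> ground (delete (contract M ?D) ?C)"
  then have Z: "Z \<subseteq> ground N1" unfolding g .
  have "rk (delete (contract M ?D) ?C) Z + rk M ?D = rk M (Z \<union> ?D)"
    by (rule rk_minor[OF matroid_meet]) (use Z e1.disj in auto)
  moreover have "rk N1 {} = 0" using rk_le_card[OF N1, of "{}"] by simp
  ultimately show "rk (delete (contract M ?D) ?C) Z = rk N1 Z" using eq[OF Z] eq[of "{}"] by simp
qed (use matroid_minor[OF matroid_meet] N1 in auto)

lemma has_minor_iso_N1: "has_minor_iso M N1"
proof -
  have "minor (delete (contract M (U1 \<union> A2)) (U2 \<union> (ground N2 - A2))) M"
    unfolding minor_def using e1.disj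
    by (intro exI[of _ "U1 \<union> A2"] exI[of _ "U2 \<union> (ground N2 - A2)"]) auto
  then show ?thesis unfolding has_minor_iso_def minor_N1 using isomorphic_refl by blast
qed

section \<open>Elements whose removal is compatible with a minor isomorphic to
  \<open>N1\<close>\<close>

lemma N1_minor_of_Q1:
  assumes not_obt: "\<not> (\<exists>N. obtainable N2 N \<and> isomorphic N N1)"
    and XY: "Y \<subseteq> ground M" "X \<inter> Y = {}" "X \<in> indeps M" "card X + rank N1 = k"
    and iso: "isomorphic (delete (contract M X) Y) N1"
  shows "isomorphic (delete (contract Q1 X) Y) N1"
proof -
  have "delete (contract M X) Y \<noteq> delete (contract Q2 X) Y"
  proof
    assume eq: "delete (contract M X) Y = delete (contract Q2 X) Y"
    have "X \<subseteq> ground M" using indep_subset_ground[OF matroid_meet XY(3)] .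
    then have "minor (delete (contract Q2 X) Y) Q2"
      unfolding minor_def using XY same_ground
      by (intro exI[of _ X] exI[of _ Y]) auto
    then have "obtainable N2 (delete (contract M X) Y)"
      using obtainable.take_minor[OF e2.obtainable_expand] eq by simp
    then show False using not_obt iso by blast
  qed
  moreover have "card (ground N1) + card (ground N2) + rank N1 \<le> k"
    using large1 rank_le_card by simp
  ultimately show ?thesis using minor_meet_cases[OF XY(3,4), of Y] iso by auto
qed

text \<open>The normal form may shift other elements, so each element of \<open>Y\<close> is treated
  on its own: not being an isthmus, \<open>e\<close> can be prescribed as deleted. The contracted
  set then has the size that the comparison with \<open>Q1\<close> demands.\<close>

lemma deleted_element_N1:
  assumes not_obt: "\<not> (\<exists>N. obtainable N2 N \<and> isomorphic N N1)"
    and ne: "nonempty_proper_cyclic_flats N1 \<noteq> {}"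
    and XY: "X \<subseteq> ground M" "Y \<subseteq> ground M" "X \<inter> Y = {}" "e \<in> Y"
    and iso: "isomorphic (delete (contract M X) Y) N1"
  shows "e \<in> U2 \<union> (ground N2 - A2) \<union> FI N1"
proof -
  obtain X' Y' where n: "X' \<union> Y' = X \<union> Y" "X' \<inter> Y' = {}" "{e} \<subseteq> Y'" "X' \<in> indeps M"
    "card X' + rank (delete (contract M X) Y) = rank M"
    "delete (contract M X') Y' = delete (contract M X) Y"
    by (rule minor_normal_form[OF matroid_meet XY(1-3) empty_subsetI empty_indep[OF matroid_meet], of "{e}"])
      (use XY rk_M_remove rank_M in auto)
  have "rank (delete (contract M X) Y) = rank N1"
    by (rule isomorphic_ranks[OF iso matroid_minor[OF matroid_meet] N1])
  then have "card X' + rank N1 = k" using n(5) rank_M by simp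
  moreover have "Y' \<subseteq> ground M" "X' \<subseteq> ground M" using n(1) XY by blast+
  ultimately have "isomorphic (delete (contract Q1 X') Y') N1"
    using n iso by (intro N1_minor_of_Q1[OF not_obt]) auto
  then show ?thesis
    using e1.deleted_element[OF ne, of X' Y' e] n(2,3) \<open>X' \<subseteq> ground M\<close> \<open>Y' \<subseteq> ground M\<close> by auto
qed

text \<open>Here \<open>e\<close> is prescribed as contracted, which is possible because
  \<open>{e}\<close> is independent.\<close>

lemma contracted_element_N1:
  assumes not_obt: "\<not> (\<exists>N. obtainable N2 N \<and> isomorphic N N1)"
    and ne: "nonempty_proper_cyclic_flats N1 \<noteq> {}"
    and XY: "X \<subseteq> ground M" "Y \<subseteq> ground M" "X \<inter> Y = {}" "e \<in> X"
    and iso: "isomorphic (delete (contract M X) Y) N1"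
  shows "e \<in> U1 \<union> A2 \<union> FI (dual N1)"
proof -
  have "e \<in> ground M" using XY by blast
  then have "{e} \<in> indeps M" using rk_M_singleton[of e] by (simp add: indep_iff_rk[OF matroid_meet])
  then obtain X' Y' where n: "X' \<union> Y' = X \<union> Y" "X' \<inter> Y' = {}" "{e} \<subseteq> X'" "X' \<in> indeps M"
    "card X' + rank (delete (contract M X) Y) = rank M"
    "delete (contract M X') Y' = delete (contract M X) Y"
    using minor_normal_form[OF matroid_meet XY(1-3), of "{e}" "{}"] XY(4) by auto
  have "rank (delete (contract M X) Y) = rank N1"
    by (rule isomorphic_ranks[OF iso matroid_minor[OF matroid_meet] N1])
  then have "card X' + rank N1 = k" using n(5) rank_M by simp
  moreover have "Y' \<subseteq> ground M" "X' \<subseteq> ground M" using n(1) XY by blast+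
  ultimately have "isomorphic (delete (contract Q1 X') Y') N1"
    using n iso by (intro N1_minor_of_Q1[OF not_obt]) auto
  then show ?thesis
    using e1.contracted_element[OF ne, of Y' X' e] n(2,3) \<open>X' \<subseteq> ground M\<close> \<open>Y' \<subseteq> ground M\<close> by auto
qed

text \<open>A minor of this minor is a minor of \<open>M\<close> with larger removed sets, to which
  the results for single elements apply.\<close>

lemma removed_elements_N1:
  assumes not_obt: "\<not> (\<exists>N. obtainable N2 N \<and> isomorphic N N1)"
    and ne: "nonempty_proper_cyclic_flats N1 \<noteq> {}"
    and XY: "X \<subseteq> ground M" "Y \<subseteq> ground M" "X \<inter> Y = {}"
    and iso: "has_minor_iso (delete (contract M X) Y) N1"
  shows "Y \<subseteq> U2 \<union> (ground N2 - A2) \<union> FI N1" "X \<subseteq> U1 \<union> A2 \<union> FI (dual N1)"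
proof -
  obtain V W where VW: "V \<subseteq> ground M - X - Y" "W \<subseteq> ground M - X - Y" "V \<inter> W = {}"
    and "isomorphic (delete (contract (delete (contract M X) Y) V) W) N1"
    using iso unfolding has_minor_iso_def minor_def by auto
  then have iso': "isomorphic (delete (contract M (X \<union> V)) (Y \<union> W)) N1"
    using minor_of_minor[OF matroid_meet XY(1) VW(1,2)] by simp
  have "X \<union> V \<subseteq> ground M" "Y \<union> W \<subseteq> ground M" "(X \<union> V) \<inter> (Y \<union> W) = {}" using XY VW by auto
  note e = this
  show "Y \<subseteq> U2 \<union> (ground N2 - A2) \<union> FI N1"
    using deleted_element_N1[OF not_obt ne e _ iso'] by blast
  show "X \<subseteq> U1 \<union> A2 \<union> FI (dual N1)"
    using contracted_element_N1[OF not_obt ne e _ iso'] by blast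
qed

lemma intertwine_M:
  assumes not_obt: "\<not> (\<exists>N. obtainable N2 N \<and> isomorphic N N1)" "\<not> (\<exists>N. obtainable N1 N \<and> isomorphic N N2)"
    and FI1: "FI N1 \<subseteq> A1" "A1 \<inter> FI (dual N1) = {}"
    and FI2: "FI N2 \<subseteq> A2" "A2 \<inter> FI (dual N2) = {}"
  shows "intertwine M N1 N2"
proof -
  interpret flip: construction N2 N1 A2 A1 U2 U1 k by (rule construction_flip)
  have M: "flip.M = M" using meet_commute[OF same_ground] .
  have "ground N1 \<noteq> {}" "ground N2 \<noteq> {}" using pos1 pos2 rank_le_card by auto
  moreover have "FI N1 \<inter> FI (dual N1) = {}" "FI N2 \<inter> FI (dual N2) = {}" using FI1 FI2 by blast+
  ultimately have ne: "nonempty_proper_cyclic_flats N1 \<noteq> {}" "nonempty_proper_cyclic_flats N2 \<noteq> {}"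
    using nonempty_proper_cyclic_flats_nonempty N1 N2 by metis+
  have FI_ground: "FI N1 \<subseteq> ground N1" "FI (dual N1) \<subseteq> ground N1" "FI N2 \<subseteq> ground N2" "FI (dual N2) \<subseteq> ground N2"
    unfolding FI_def by auto
  have False if "proper_minor M' M" and iso: "has_minor_iso M' N1" "has_minor_iso M' N2" for M'
  proof -
    have neq: "M' \<noteq> M" and "minor M' M" using that(1) unfolding proper_minor_def by simp_all
    then obtain X Y where XY: "X \<subseteq> ground M" "Y \<subseteq> ground M" "X \<inter> Y = {}" "M' = delete (contract M X) Y"
      unfolding minor_def by (elim exE conjE)
    note r1 = removed_elements_N1[OF not_obt(1) ne(1) XY(1-3) iso(1)[unfolded XY(4)]]
    note r2 = flip.removed_elements_N1[unfolded M, OF not_obt(2) ne(2) XY(1-3) iso(2)[unfolded XY(4)]]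
    \<comment> \<open>\<open>FI N1\<close> lies in \<open>A1\<close> and so misses
      \<open>ground N1 - A1\<close>; likewise for \<open>N2\<close>.\<close>
    have "(U2 \<union> (ground N2 - A2) \<union> FI N1) \<inter> (U1 \<union> (ground N1 - A1) \<union> FI N2) = {}"
      using FI1(1) FI2(1) FI_ground(1,3) disj by blast
    then have "Y = {}" using r1(1) r2(1) by blast
    \<comment> \<open>The dual half of the choice of \<open>A1\<close> and \<open>A2\<close>: each
      avoids the cofree elements and loops of its matroid.\<close>
    moreover have "(U1 \<union> A2 \<union> FI (dual N1)) \<inter> (U2 \<union> A1 \<union> FI (dual N2)) = {}"
      using FI1(2) FI2(2) FI_ground(2,4) A1 A2 disj by blast
    then have "X = {}" using r1(2) r2(2) by blast
    moreover have "delete (contract M {}) {} = M"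
    proof (rule mat.equality)
      have "Z \<in> indeps (delete (contract M {}) {}) \<longleftrightarrow> Z \<in> indeps M" for Z
        using indep_minor[OF matroid_meet empty_indep[OF matroid_meet], of Z "{}"]
          indep_subset_ground[OF matroid_meet, of Z] by (simp only: Diff_empty Un_empty_right) blast
      then show "indeps (delete (contract M {}) {}) = indeps M" by blast
    qed simp_all
    ultimately show False using neq XY(4) by simp
  qed
  then show ?thesis
    unfolding intertwine_def using matroid_meet has_minor_iso_N1 flip.has_minor_iso_N1[unfolded M] by blast
qed

end

theorem theorem3p3:
  fixes M1 M2 :: "'a::infinite mat"
    and S1' S2' T1 T2 :: "'a set"
    and k :: nat
  assumes "matroid M1" and "matroid M2"
    and "rank M1 > 0" and "rank M2 > 0"
    and "ground M1 \<inter> ground M2 = {}"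
    and "\<not> (\<exists>N. obtainable M2 N \<and> isomorphic N M1)"
    and "\<not> (\<exists>N. obtainable M1 N \<and> isomorphic N M2)"
    and "FI M1 \<subseteq> S1'" and "S1' \<subseteq> ground M1 - FI (dual M1)"
    and "FI M2 \<subseteq> S2'" and "S2' \<subseteq> ground M2 - FI (dual M2)"
    and "k \<ge> 4 * max (card (ground M1)) (card (ground M2))"
    and "finite T1" and "int (card T1) = int k - int (rank M1) - int (card S2')"
    and "finite T2" and "int (card T2) = int k - int (rank M2) - int (card S1')"
    and "T1 \<inter> T2 = {}"
    and "T1 \<inter> (ground M1 \<union> ground M2) = {}"
    and "T2 \<inter> (ground M1 \<union> ground M2) = {}"
  shows "intertwine (M_construction k M1 S1' T1 M2 S2' T2) M1 M2"
proof -
  \<comment> \<open>Both size conditions of the locale have left-hand sides at most three times the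
    size of the larger ground set. The integer equations for the sizes of \<open>T1\<close> and
    \<open>T2\<close> become sums of natural numbers.\<close>
  interpret construction M1 M2 S1' S2' T1 T2 k
    by unfold_locales (use assms in auto)
  show ?thesis
    unfolding M_construction_eq by (rule intertwine_M) (use assms in auto)
qed

end
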